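(* Let $k,m,p\ge 1$ be integers and let $\Phi_1,\dots,\Phi_p$ be real $k\times m$ matrices with $\Phi_p\neq 0$ (the coefficients of the regression model $y_t=\sum_{i=1}^p\Phi_i x_{t-i}+\epsilon_t$). Then there exist integers $d_1,\dots,d_p\ge 0$ with $d_p>0$ and $\mathfrak l:=\sum_{i=1}^p d_i\le \min(k,m)$, a real $n_{\min}\times m$ matrix $G$ and a real $k\times n_{\min}$ matrix $H$, where $n_{\min}=\sum_{i=1}^p i\,d_i$, such that, with $F$ the nilpotent Jordan matrix of structure $[d_1,\dots,d_p]$ (so $F^p=0$): (a) $\{H,F,G\}$ is a minimal state-space realization of $Z(s)=\sum_{i=1}^p\Phi_i s^{-i}$, that is, $Z(s)=H(sI-F)^{-1}G$ with state dimension as small as possible; equivalently $\sum_{i=1}^p\Phi_iL^i=H(I-FL)^{-1}GL$, so that $\Phi_i=HF^{i-1}G$ for $1\le i\le p$; (b) the $\mathfrak l\times m$ matrix $G_{:,0}$ and the $k\times\mathfrak l$ matrix $H_{:,0}$ both have rank $\mathfrak l$. Consequently the model can be written $y_t=\sum_{i=1}^pHF^{i-1}G\,x_{t-i}+\epsilon_t$.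
   Context: For $r\ge1$, $d\ge0$, $K(r,d)=J_r\otimes I_d$, where $J_r$ is the $r\times r$ matrix with ones on the first superdiagonal and zeros elsewhere. The nilpotent Jordan matrix of structure $[d_1,\dots,d_p]$ is $F=\mathrm{diag}(K(p,d_p),K(p-1,d_{p-1}),\dots,K(1,d_1))$, of size $n_{\min}\times n_{\min}$ (blocks with $d_r=0$ are empty and skipped). The rows of an $n_{\min}\times m$ matrix $G$ are partitioned into blocks $G_{r,j}$ of size $d_r\times m$, $1\le r\le p$, $0\le j\le r-1$, stacked from top to bottom with $r$ descending from $p$ to $1$ and, for each $r$, $j$ descending from $r-1$ to $0$. The columns of a $k\times n_{\min}$ matrix $H$ are partitioned into blocks $H_{r,j}$ of size $k\times d_r$, arranged from left to right with $r$ descending from $p$ to $1$ and, for each $r$, $j$ ascending from $0$ to $r-1$. $G_{:,0}$ is the vertical stack of $G_{p,0},G_{p-1,0},\dots,G_{1,0}$, and $H_{:,0}$ is the horizontal concatenation of $H_{p,0},H_{p-1,0},\dots,H_{1,0}$. A state-space realization of a strictly proper rational matrix $Z(s)$ is a triple $\{H,F,G\}$ with $Z(s)=H(sI-F)^{-1}G$; its state dimension is the size of $F$; it is minimal if no realization of smaller state dimension exists. $L$ denotes the lag operator (formal variable, $L=s^{-1}$). *)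

theory Defs
  imports
    "Jordan_Normal_Form.DL_Rank"
    "Jordan_Normal_Form.Gauss_Jordan_Elimination"
    "Jordan_Normal_Form.Jordan_Normal_Form"
    "HOL-Computational_Algebra.Polynomial_Factorial"
begin

definition kronecker :: "real mat \<Rightarrow> real mat \<Rightarrow> real mat" where
  "kronecker A B =
     mat (dim_row A * dim_row B) (dim_col A * dim_col B)
       (\<lambda>(i, j). A $$ (i div dim_row B, j div dim_col B)
               * B $$ (i mod dim_row B, j mod dim_col B))"

definition K_block :: "nat \<Rightarrow> nat \<Rightarrow> real mat" where
  "K_block r e = kronecker (jordan_block r 0) (1\<^sub>m e)"

text \<open>A structure \<open>[d\<^sub>1,\<dots>,d\<^sub>p]\<close> is a pair of \<open>p\<close> and a function \<open>d\<close>, of which only the values on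
  \<open>{1..p}\<close> matter.\<close>

definition nilpotent_jordan :: "nat \<Rightarrow> (nat \<Rightarrow> nat) \<Rightarrow> real mat" where
  "nilpotent_jordan p d = diag_block_mat (map (\<lambda>r. K_block r (d r)) (rev [1..<Suc p]))"

text \<open>\<open>block_start p d r\<close> is the number of rows of \<open>G\<close> (columns of \<open>H\<close>) that precede all blocks with
  first index \<open>r\<close>. For given \<open>r\<close>, the blocks of \<open>G\<close> have \<open>j\<close> descending and those of \<open>H\<close> have
  \<open>j\<close> ascending.\<close>

definition block_start :: "nat \<Rightarrow> (nat \<Rightarrow> nat) \<Rightarrow> nat \<Rightarrow> nat" where
  "block_start p d r = (\<Sum>r'\<in>{r<..p}. r' * d r')"

definition G_block :: "nat \<Rightarrow> (nat \<Rightarrow> nat) \<Rightarrow> real mat \<Rightarrow> nat \<Rightarrow> nat \<Rightarrow> real mat" where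
  "G_block p d G r j =
     mat (d r) (dim_col G) (\<lambda>(a, b). G $$ (block_start p d r + (r - 1 - j) * d r + a, b))"

definition H_block :: "nat \<Rightarrow> (nat \<Rightarrow> nat) \<Rightarrow> real mat \<Rightarrow> nat \<Rightarrow> nat \<Rightarrow> real mat" where
  "H_block p d H r j =
     mat (dim_row H) (d r) (\<lambda>(a, b). H $$ (a, block_start p d r + j * d r + b))"

definition append_cols :: "real mat \<Rightarrow> real mat \<Rightarrow> real mat" where
  "append_cols A B = four_block_mat A B (0\<^sub>m 0 (dim_col A)) (0\<^sub>m 0 (dim_col B))"

definition G_zero :: "nat \<Rightarrow> (nat \<Rightarrow> nat) \<Rightarrow> real mat \<Rightarrow> real mat" where
  "G_zero p d G =
     foldr append_rows (map (\<lambda>r. G_block p d G r 0) (rev [1..<Suc p])) (0\<^sub>m 0 (dim_col G))"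

definition H_zero :: "nat \<Rightarrow> (nat \<Rightarrow> nat) \<Rightarrow> real mat \<Rightarrow> real mat" where
  "H_zero p d H =
     foldr append_cols (map (\<lambda>r. H_block p d H r 0) (rev [1..<Suc p])) (0\<^sub>m (dim_row H) 0)"

text \<open>Rational matrices are matrices over \<open>\<real>(s)\<close>, rendered as \<open>real poly fract\<close>.\<close>

definition s_var :: "real poly fract" where
  "s_var = to_fract [:0, 1:]"

definition lag :: "real poly fract" where
  "lag = inverse s_var"

definition const_mat :: "real mat \<Rightarrow> real poly fract mat" where
  "const_mat = map_mat (\<lambda>c. to_fract [:c:])"

definition sum_of_mats :: "nat \<Rightarrow> nat \<Rightarrow> ('i \<Rightarrow> 'a::comm_monoid_add mat) \<Rightarrow> 'i set \<Rightarrow> 'a mat" where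
  "sum_of_mats nr nc A I = mat nr nc (\<lambda>ij. \<Sum>i\<in>I. A i $$ ij)"

definition transfer_matrix :: "nat \<Rightarrow> nat \<Rightarrow> nat \<Rightarrow> (nat \<Rightarrow> real mat) \<Rightarrow> real poly fract mat" where
  "transfer_matrix k m p \<Phi> =
     sum_of_mats k m (\<lambda>i. inverse s_var ^ i \<cdot>\<^sub>m const_mat (\<Phi> i)) {1..p}"

definition lag_polynomial :: "nat \<Rightarrow> nat \<Rightarrow> nat \<Rightarrow> (nat \<Rightarrow> real mat) \<Rightarrow> real poly fract mat" where
  "lag_polynomial k m p \<Phi> = sum_of_mats k m (\<lambda>i. lag ^ i \<cdot>\<^sub>m const_mat (\<Phi> i)) {1..p}"

definition realization ::
    "real mat \<Rightarrow> real mat \<Rightarrow> real mat \<Rightarrow> real poly fract mat \<Rightarrow> bool" where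
  "realization H F G Z \<longleftrightarrow>
     F \<in> carrier_mat (dim_row F) (dim_row F) \<and>
     H \<in> carrier_mat (dim_row Z) (dim_row F) \<and>
     G \<in> carrier_mat (dim_row F) (dim_col Z) \<and>
     (\<exists>R. mat_inverse (s_var \<cdot>\<^sub>m 1\<^sub>m (dim_row F) - const_mat F) = Some R \<and>
          Z = const_mat H * R * const_mat G)"

definition minimal_realization ::
    "real mat \<Rightarrow> real mat \<Rightarrow> real mat \<Rightarrow> real poly fract mat \<Rightarrow> bool" where
  "minimal_realization H F G Z \<longleftrightarrow>
     realization H F G Z \<and>
     (\<forall>H' F' G'. realization H' F' G' Z \<longrightarrow> dim_row F \<le> dim_row F')"

definition lag_representation ::
    "real mat \<Rightarrow> real mat \<Rightarrow> real mat \<Rightarrow> real poly fract mat \<Rightarrow> bool" where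
  "lag_representation H F G P \<longleftrightarrow>
     (\<exists>R. mat_inverse (1\<^sub>m (dim_row F) - lag \<cdot>\<^sub>m const_mat F) = Some R \<and>
          P = lag \<cdot>\<^sub>m (const_mat H * R * const_mat G))"

definition regression_model ::
    "nat \<Rightarrow> nat \<Rightarrow> (nat \<Rightarrow> real mat) \<Rightarrow> (int \<Rightarrow> real vec) \<Rightarrow> (int \<Rightarrow> real vec) \<Rightarrow> (int \<Rightarrow> real vec) \<Rightarrow> bool"
  where
  "regression_model k p \<Phi> x \<epsilon> y \<longleftrightarrow>
     (\<forall>t. y t = finsum_vec TYPE(real) k (\<lambda>i. \<Phi> i *\<^sub>v x (t - int i)) {1..p} + \<epsilon> t)"

end

theory Submission
  imports Defs "HOL-Computational_Algebra.Formal_Power_Series"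
begin

text \<open>Gaussian elimination over \<open>\<real>[[s]]\<close>, always with a pivot of least order, writes \<open>s\<^sup>p Z(s)\<close>
  modulo \<open>s\<^sup>p\<close> as a sum of terms \<open>s\<^bsup>p - n\<^sub>c\<^esup> u\<^sub>c v\<^sub>c\<^sup>T\<close> with \<open>n\<^sub>1 \<ge> n\<^sub>2 \<ge> \<dots> \<ge> 1\<close> in which both the \<open>u\<^sub>c(0)\<close>
  and the \<open>v\<^sub>c(0)\<close> are in echelon form (local Smith form at \<open>0\<close>). Each term is a Jordan chain of
  length \<open>n\<^sub>c\<close>: the coefficients of \<open>u\<^sub>c\<close> are its columns of \<open>H\<close>, those of \<open>v\<^sub>c\<close> its rows of \<open>G\<close>, so that
  \<open>H\<^bsub>:,0\<^esub>\<close> and \<open>G\<^bsub>:,0\<^esub>\<close> consist of the \<open>u\<^sub>c(0)\<close> and \<open>v\<^sub>c(0)\<close>.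
  Minimality: for a realization of smaller dimension, some nonzero polynomial vector \<open>w\<close> in an
  \<open>n\<^bsub>min\<^esub>\<close>-dimensional space, with one pivot column and degree below \<open>n\<^sub>c\<close> for each chain \<open>c\<close>, would make
  \<open>Z w\<close> polynomial; but observability and reachability of the chains are triangular systems, which
  force \<open>w = 0\<close>.\<close>

section \<open>Pivot decomposition and triangular systems\<close>

text \<open>Induction on the number of rows still in play. A pivot \<open>A x0 y0\<close> of least
  order \<epsilon> is split off; since X^\<epsilon> divides every entry, subtracting X^\<epsilon>
  \<open>u0 v0\<close> clears row \<open>x0\<close> and column \<open>y0\<close>. The process stops
  when every entry has order at least \<open>p\<close>. The support clause gives the zeros at
  earlier pivots, the clause quantified over \<open>q\<close> the monotonicity of
  \<open>e\<close>.\<close>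

lemma fps_pivot_decomposition:
  fixes A :: "nat \<Rightarrow> nat \<Rightarrow> real fps"
  assumes "finite R" "finite S" "\<forall>x y. x \<notin> R \<or> y \<notin> S \<longrightarrow> A x y = 0"
  shows "\<exists>(l::nat) e u v xs ys.
    (\<forall>c<l. xs c \<in> R \<and> ys c \<in> S \<and> e c < p) \<and>
    (\<forall>c<l. (\<forall>x. x \<notin> R \<longrightarrow> u c x = 0) \<and> (\<forall>y. y \<notin> S \<longrightarrow> v c y = 0)) \<and>
    (\<forall>c<l. fps_nth (u c (xs c)) 0 \<noteq> 0 \<and> fps_nth (v c (ys c)) 0 \<noteq> 0) \<and>
    (\<forall>c' c. c < c' \<longrightarrow> c' < l \<longrightarrow> u c' (xs c) = 0 \<and> v c' (ys c) = 0 \<and> e c \<le> e c') \<and>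
    (\<forall>q. (\<forall>x y. \<forall>i<q. fps_nth (A x y) i = 0) \<longrightarrow> (\<forall>c<l. q \<le> e c)) \<and>
    (\<forall>x y. \<forall>i<p. fps_nth (A x y) i = fps_nth (\<Sum>c<l. fps_X ^ e c * u c x * v c y) i)"
  using assms
proof (induction "card R" arbitrary: R S A rule: less_induct)
  case (less R S A)
  show ?case
  proof (cases "\<forall>x y. \<forall>i<p. fps_nth (A x y) i = 0")
    case True
    then show ?thesis by (intro exI[of _ "0::nat"]) simp
  next
    case False
    define \<epsilon> where "\<epsilon> = (LEAST i. \<exists>x y. fps_nth (A x y) i \<noteq> 0)"
    from False obtain x1 y1 i1 where 1: "i1 < p" "fps_nth (A x1 y1) i1 \<noteq> 0" by blast
    then have "\<exists>x y. fps_nth (A x y) \<epsilon> \<noteq> 0"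
      using LeastI[of "\<lambda>i. \<exists>x y. fps_nth (A x y) i \<noteq> 0" i1] unfolding \<epsilon>_def by blast
    then obtain x0 y0 where nz: "fps_nth (A x0 y0) \<epsilon> \<noteq> 0" by blast
    have "\<epsilon> \<le> i1" unfolding \<epsilon>_def by (rule Least_le) (use 1 in blast)
    then have \<epsilon>p: "\<epsilon> < p" using 1 by simp
    have low: "fps_nth (A x y) i = 0" if "i < \<epsilon>" for x y i
      using not_less_Least[of i "\<lambda>i. \<exists>x y. fps_nth (A x y) i \<noteq> 0"] that unfolding \<epsilon>_def by blast
    have x0R: "x0 \<in> R" and y0S: "y0 \<in> S"
      using less.prems(3) nz by (metis fps_zero_nth)+
    define A' where "A' x y = fps_shift \<epsilon> (A x y)" for x y
    have A': "A x y = fps_X ^ \<epsilon> * A' x y" for x y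
      by (rule fps_ext) (auto simp: A'_def fps_X_power_mult_nth low)
    have unit: "fps_nth (A' x0 y0) 0 \<noteq> 0" using nz by (simp add: A'_def)
    define u0 where "u0 x = A' x y0" for x
    define v0 where "v0 y = A' x0 y * inverse (A' x0 y0)" for y
    have inv1: "A' x0 y0 * inverse (A' x0 y0) = 1" using unit by (rule inverse_mult_eq_1')
    \<comment> \<open>The remainder after one elimination step; \<open>v0\<close> carries the
      inverse of the unit part of the pivot, so \<open>v0 y0\<close> is 1.\<close>
    define B where "B x y = A x y - fps_X ^ \<epsilon> * u0 x * v0 y" for x y
    have A'0: "A' x y = 0" if "x \<notin> R \<or> y \<notin> S" for x y
      using less.prems(3) that by (simp add: A'_def)
    have B0: "\<forall>x y. x \<notin> R - {x0} \<or> y \<notin> S - {y0} \<longrightarrow> B x y = 0"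
    proof (intro allI impI)
      fix x y assume out: "x \<notin> R - {x0} \<or> y \<notin> S - {y0}"
      have "B x0 y = 0"
      proof -
        have "fps_X ^ \<epsilon> * u0 x0 * v0 y = fps_X ^ \<epsilon> * A' x0 y * (A' x0 y0 * inverse (A' x0 y0))"
          by (simp only: u0_def v0_def mult_ac)
        then show ?thesis by (simp add: B_def A' inv1)
      qed
      moreover have "B x y0 = 0"
        by (simp add: B_def A' u0_def v0_def inv1)
      moreover have "B x y = 0" if "x \<notin> R \<or> y \<notin> S"
        using less.prems(3) A'0[of x y0] A'0[of x0 y] that by (auto simp: B_def u0_def v0_def)
      ultimately show "B x y = 0" using out by auto
    qed
    have "card (R - {x0}) < card R" using x0R less.prems(1) by (rule card_Diff1_less[rotated])
    from less.hyps[where S = "S - {y0}" and A = B, OF this finite_Diff finite_Diff B0, OF less.prems(1,2)]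
    obtain l :: nat and e u v xs ys where
      IH: "\<forall>c<l. xs c \<in> R - {x0} \<and> ys c \<in> S - {y0} \<and> e c < p"
       "\<forall>c<l. (\<forall>x. x \<notin> R - {x0} \<longrightarrow> u c x = 0) \<and> (\<forall>y. y \<notin> S - {y0} \<longrightarrow> v c y = 0)"
       "\<forall>c<l. fps_nth (u c (xs c)) 0 \<noteq> 0 \<and> fps_nth (v c (ys c)) 0 \<noteq> 0"
       "\<forall>c' c. c < c' \<longrightarrow> c' < l \<longrightarrow> u c' (xs c) = 0 \<and> v c' (ys c) = 0 \<and> e c \<le> e c'"
       "\<forall>q. (\<forall>x y. \<forall>i<q. fps_nth (B x y) i = 0) \<longrightarrow> (\<forall>c<l. q \<le> e c)"
       "\<forall>x y. \<forall>i<p. fps_nth (B x y) i = fps_nth (\<Sum>c<l. fps_X ^ e c * u c x * v c y) i"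
      by (elim exE conjE) (rule that; assumption)
    \<comment> \<open>Elimination does not lower the least order, so all later exponents are at
      least \<epsilon>.\<close>
    have "\<forall>x y. \<forall>i<\<epsilon>. fps_nth (B x y) i = 0"
      by (simp add: B_def low mult.assoc fps_X_power_mult_nth)
    with IH(5) have eg: "\<forall>c<l. \<epsilon> \<le> e c" by blast
    have vS: "v0 y0 = 1" using inv1 by (simp add: v0_def)
    have q\<epsilon>: "q \<le> \<epsilon>" if "\<forall>x y. \<forall>i<q. fps_nth (A x y) i = 0" for q
      using that nz not_less by blast
    \<comment> \<open>The new pivot becomes index 0 and the recursive ones move up by one.\<close>
    let ?cons = "\<lambda>a f c. case c of 0 \<Rightarrow> a | Suc c' \<Rightarrow> f c'"
    show ?thesis
    proof (rule exI[of _ "Suc l"], rule exI[of _ "?cons \<epsilon> e"], rule exI[of _ "?cons u0 u"],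
        rule exI[of _ "?cons v0 v"], rule exI[of _ "?cons x0 xs"], rule exI[of _ "?cons y0 ys"],
        intro conjI)
      show "\<forall>c<Suc l. ?cons x0 xs c \<in> R \<and> ?cons y0 ys c \<in> S \<and> ?cons \<epsilon> e c < p"
        using IH(1) x0R y0S \<epsilon>p by (auto split: nat.split)
      show "\<forall>c<Suc l. (\<forall>x. x \<notin> R \<longrightarrow> ?cons u0 u c x = 0) \<and> (\<forall>y. y \<notin> S \<longrightarrow> ?cons v0 v c y = 0)"
        using IH(2) A'0 by (auto split: nat.split simp: u0_def v0_def)
      show "\<forall>c<Suc l. fps_nth (?cons u0 u c (?cons x0 xs c)) 0 \<noteq> 0 \<and>
          fps_nth (?cons v0 v c (?cons y0 ys c)) 0 \<noteq> 0"
        using IH(3) unit vS by (auto split: nat.split simp: u0_def)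
      show "\<forall>c' c. c < c' \<longrightarrow> c' < Suc l \<longrightarrow> ?cons u0 u c' (?cons x0 xs c) = 0 \<and>
          ?cons v0 v c' (?cons y0 ys c) = 0 \<and> ?cons \<epsilon> e c \<le> ?cons \<epsilon> e c'"
        using IH(2,4) eg by (auto split: nat.split)
      show "\<forall>q. (\<forall>x y. \<forall>i<q. fps_nth (A x y) i = 0) \<longrightarrow> (\<forall>c<Suc l. q \<le> ?cons \<epsilon> e c)"
      proof (intro allI impI)
        fix q c assume "\<forall>x y. \<forall>i<q. fps_nth (A x y) i = 0" "c < Suc l"
        then show "q \<le> ?cons \<epsilon> e c"
          using q\<epsilon> eg le_trans[of q \<epsilon>] by (cases c) auto
      qed
      show "\<forall>x y. \<forall>i<p. fps_nth (A x y) i =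
          fps_nth (\<Sum>c<Suc l. fps_X ^ ?cons \<epsilon> e c * ?cons u0 u c x * ?cons v0 v c y) i"
      proof (intro allI impI)
        fix x y i assume "i < p"
        then have "fps_nth (B x y) i = fps_nth (\<Sum>c<l. fps_X ^ e c * u c x * v c y) i"
          using IH(6) by blast
        then show "fps_nth (A x y) i =
            fps_nth (\<Sum>c<Suc l. fps_X ^ ?cons \<epsilon> e c * ?cons u0 u c x * ?cons v0 v c y) i"
          unfolding sum.lessThan_Suc_shift nat.case fps_add_nth B_def fps_sub_nth by linarith
      qed
    qed
  qed
qed

text \<open>Well-founded substitution: in equation \<open>c\<close> every unknown preceding
  \<open>c\<close> is already zero and every other off-diagonal coefficient vanishes, leaving
  \<open>T c c * w c = 0\<close>. A general \<open>r\<close> admits lexicographic orders on index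
  pairs.\<close>

lemma triangular_kernel_trivial:
  fixes T :: "'a \<Rightarrow> 'a \<Rightarrow> real"
  assumes "finite I" and "wf r"
    and diag: "\<And>c. c \<in> I \<Longrightarrow> T c c \<noteq> 0"
    and tri: "\<And>c c'. c \<in> I \<Longrightarrow> c' \<in> I \<Longrightarrow> c \<noteq> c' \<Longrightarrow> (c', c) \<notin> r \<Longrightarrow> T c c' = 0"
    and ker: "\<And>c. c \<in> I \<Longrightarrow> (\<Sum>c'\<in>I. T c c' * w c') = 0"
    and "c \<in> I"
  shows "w c = 0"
  using \<open>wf r\<close> \<open>c \<in> I\<close>
proof (induction c rule: wf_induct_rule)
  case (less c)
  have "(\<Sum>c'\<in>I - {c}. T c c' * w c') = 0"
  proof (intro sum.neutral ballI)
    fix c' assume "c' \<in> I - {c}"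
    then show "T c c' * w c' = 0"
      using less.IH[of c'] tri[of c c'] less.prems by (cases "(c', c) \<in> r") auto
  qed
  then have "T c c * w c = 0"
    using ker[OF less.prems] sum.remove[OF \<open>finite I\<close> less.prems, of "\<lambda>c'. T c c' * w c'"] by simp
  then show ?case using diag[OF less.prems] by simp
qed

text \<open>A homogeneous system with fewer equations than unknowns. Induction on the number of
  equations: solve the last one for an unknown \<open>a\<close> and substitute.\<close>

lemma nontrivial_kernel:
  fixes q :: "'a \<Rightarrow> nat \<Rightarrow> real"
  assumes "finite I" "N < card I"
  shows "\<exists>w. (\<exists>e\<in>I. w e \<noteq> 0) \<and> (\<forall>j<N. (\<Sum>e\<in>I. w e * q e j) = 0)"
  using assms
proof (induction N arbitrary: I q)
  case 0
  then have "I \<noteq> {}" by auto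
  then show ?case by (intro exI[of _ "\<lambda>_. 1"]) auto
next
  case (Suc N)
  show ?case
  proof (cases "\<forall>e\<in>I. q e N = 0")
    case True
    then show ?thesis
      using Suc.IH[of I q] Suc.prems by (auto simp: less_Suc_eq)
  next
    case False
    then obtain a where a: "a \<in> I" "q a N \<noteq> 0" by blast
    define q' where "q' e j = q e j - q e N / q a N * q a j" for e j
    have "N < card (I - {a})" using a Suc.prems by simp
    with Suc.IH[of "I - {a}" q'] Suc.prems obtain w where
      w: "\<exists>e\<in>I - {a}. w e \<noteq> 0" "\<forall>j<N. (\<Sum>e\<in>I - {a}. w e * q' e j) = 0" by auto
    \<comment> \<open>The value of the unknown \<open>a\<close> that equation \<open>N\<close>
      forces.\<close>
    define b where "b = - (\<Sum>e\<in>I - {a}. w e * (q e N / q a N))"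
    have split: "(\<Sum>e\<in>I. (w(a := b)) e * q e j) = (\<Sum>e\<in>I - {a}. w e * q' e j)" for j
    proof -
      have "(\<Sum>e\<in>I. (w(a := b)) e * q e j) = b * q a j + (\<Sum>e\<in>I - {a}. w e * q e j)"
        using a Suc.prems(1) by (subst sum.remove[of I a]) auto
      then show ?thesis
        by (simp only: b_def q'_def)
          (simp add: sum_subtractf sum_distrib_left sum_distrib_right right_diff_distrib mult_ac)
    qed
    have "(\<Sum>e\<in>I - {a}. w e * q' e N) = 0"
      using a by (simp add: q'_def)
    with split w(2) have "\<forall>j<Suc N. (\<Sum>e\<in>I. (w(a := b)) e * q e j) = 0"
      by (auto simp: less_Suc_eq)
    moreover have "\<exists>e\<in>I. (w(a := b)) e \<noteq> 0" using w(1) by auto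
    ultimately show ?thesis by blast
  qed
qed

text \<open>The convolution for the product, with \<open>q\<close> as a position in a chain of
  length \<open>N\<close>. The left factor is an entry of H F^s and the right one an entry of F^t G,
  so this is the Hankel factorization for a single chain.\<close>

lemma fps_mult_nth_shifted:
  fixes f g :: "real fps"
  shows "(if s + t + 1 \<le> N then fps_nth (f * g) (N - (s + t + 1)) else 0) =
    (\<Sum>q<N. (if s \<le> q then fps_nth f (q - s) else 0) *
      (if q + t < N then fps_nth g (N - 1 - t - q) else 0))"
    (is "?lhs = sum ?h _")
proof (cases "s + t + 1 \<le> N")
  case True
  define M where "M = N - (s + t + 1)"
  have "sum ?h {..<N} = sum ?h {0 + s..M + s}"
    by (rule sum.mono_neutral_right) (use True in \<open>auto simp: M_def\<close>)
  also have "\<dots> = (\<Sum>i=0..M. ?h (i + s))"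
    by (rule sum.shift_bounds_cl_nat_ivl)
  also have "\<dots> = (\<Sum>i=0..M. fps_nth f i * fps_nth g (M - i))"
  proof (rule sum.cong[OF refl])
    fix i assume "i \<in> {0..M}"
    then have "i + s + t < N" "N - 1 - t - (i + s) = M - i" using True by (auto simp: M_def)
    then show "?h (i + s) = fps_nth f i * fps_nth g (M - i)" by simp
  qed
  finally show ?thesis using True by (simp add: fps_mult_nth M_def)
next
  case False
  then have "sum ?h {..<N} = 0" by (intro sum.neutral) auto
  then show ?thesis using False by simp
qed

text \<open>The first triangular system is observability, for the intermediate state \<open>z\<close>; the second one
  is reachability of \<open>z\<close> from the inputs \<open>w\<close>.\<close>

lemma hankel_kernel_trivial:
  fixes u v :: "nat \<Rightarrow> nat \<Rightarrow> real fps" and n xs ys :: "nat \<Rightarrow> nat"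
    and l :: nat
  defines "I \<equiv> SIGMA c:{..<l}. {..<n c}"
  assumes piv: "\<And>c. c < l \<Longrightarrow> fps_nth (u c (xs c)) 0 \<noteq> 0 \<and> fps_nth (v c (ys c)) 0 \<noteq> 0"
    and tri: "\<And>c c'. c < c' \<Longrightarrow> c' < l \<Longrightarrow> u c' (xs c) = 0 \<and> v c' (ys c) = 0"
    and \<phi>: "\<And>i x y. \<phi> i x y =
      (\<Sum>c<l. if i \<le> n c then fps_nth (u c x * v c y) (n c - i) else 0)"
    and ker: "\<And>c s. c < l \<Longrightarrow> (\<Sum>(c',t)\<in>I. w (c',t) * \<phi> (s + t + 1) (xs c) (ys c')) = 0"
    and "e \<in> I"
  shows "w e = 0"
proof -
  have fin: "finite I" by (simp add: I_def)
  \<comment> \<open>\<open>U\<close> is the observability factor, \<open>V\<close> the reachability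
    factor, and \<open>z\<close> the state that the inputs \<open>w\<close> at the pivot columns
    produce.\<close>
  define U where "U s x c q = (if s \<le> q then fps_nth (u c x) (q - s) else 0)" for s x c q
  define V where "V c q y t = (if q + t < n c then fps_nth (v c y) (n c - 1 - t - q) else 0)"
    for c q y t
  define z where "z c q = (\<Sum>(c',t)\<in>I. V c q (ys c') t * w (c',t))" for c q
  have \<phi>UV: "\<phi> (s + t + 1) x y = (\<Sum>(c,q)\<in>I. U s x c q * V c q y t)" for s t x y
    unfolding \<phi> fps_mult_nth_shifted I_def U_def V_def by (subst sum.Sigma[symmetric]) auto
  have obs: "(\<Sum>(c,q)\<in>I. U s (xs c0) c q * z c q) = 0" if "c0 < l" for c0 s
  proof -
    have "(\<Sum>(c,q)\<in>I. U s (xs c0) c q * z c q) =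
        (\<Sum>(c,q)\<in>I. \<Sum>(c',t)\<in>I. w (c',t) * (U s (xs c0) c q * V c q (ys c') t))"
      unfolding z_def by (auto simp: sum_distrib_left mult_ac intro!: sum.cong)
    also have "\<dots> = (\<Sum>(c',t)\<in>I. \<Sum>(c,q)\<in>I. w (c',t) * (U s (xs c0) c q * V c q (ys c') t))"
      by (simp add: case_prod_unfold) (rule sum.swap)
    also have "\<dots> = (\<Sum>(c',t)\<in>I. w (c',t) * \<phi> (s + t + 1) (xs c0) (ys c'))"
      unfolding \<phi>UV by (simp add: case_prod_unfold sum_distrib_left)
    finally show ?thesis using ker[OF that] by simp
  qed
  \<comment> \<open>A strict bound on all chain positions, so that \<open>P - s\<close> reverses
    their order.\<close>
  define P where "P = Suc (\<Sum>c<l. n c)"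
  have nP: "n c < P" if "c < l" for c
    using member_le_sum[of c "{..<l}" n] that by (auto simp: P_def)
  have z0: "z c q = 0" if "(c, q) \<in> I" for c q
  proof -
    \<comment> \<open>Observability at the pivot rows: a coefficient vanishes for
      \<open>q < s\<close>, and for \<open>q = s\<close> it is a constant term, zero if
      \<open>c < c'\<close>. Unknowns are therefore eliminated from large positions down, and at
      equal positions from the first chain on.\<close>
    let ?T = "\<lambda>(c,s) (c',q). U s (xs c) c' q"
    let ?r = "inv_image (less_than <*lex*> less_than) (\<lambda>(c,s). (P - s, c))"
    have "case_prod z (c, q) = 0"
    proof (rule triangular_kernel_trivial[OF fin, of ?r ?T])
      show "wf ?r" by (intro wf_inv_image wf_lex_prod wf_less_than)
      show "?T a a \<noteq> 0" if "a \<in> I" for a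
        using that piv by (auto simp: I_def U_def)
      show "?T a b = 0" if "a \<in> I" "b \<in> I" "a \<noteq> b" "(b, a) \<notin> ?r" for a b
      proof -
        obtain c s c' q where ab: "a = (c, s)" "b = (c', q)" by (cases a, cases b) auto
        then have "c < l" "s < n c" "c' < l" "q < n c'" using that by (auto simp: I_def)
        moreover have "q < P" "s < P" using nP calculation by (meson less_trans)+
        ultimately show ?thesis
          using that tri[of c c'] ab by (auto simp: U_def)
      qed
      show "(\<Sum>b\<in>I. ?T a b * case_prod z b) = 0" if "a \<in> I" for a
        using obs[of "fst a" "snd a"] that by (auto simp: I_def case_prod_unfold)
    qed (use that in simp)
    then show ?thesis by simp
  qed
  \<comment> \<open>Counting positions from the end of the chain turns the coefficient of
    \<open>v c\<close> into \<open>j - t\<close>. The system is triangular in \<open>t\<close>, and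
    at \<open>t = j\<close> triangular in the chains in the opposite direction, since there
    \<open>v c\<close> vanishes at the pivots of earlier chains.\<close>
  let ?T = "\<lambda>(c,j) (c',t). V c (n c - 1 - j) (ys c') t"
  let ?r = "inv_image (less_than <*lex*> less_than) (\<lambda>(c,j). (j, l - c))"
  show ?thesis
  proof (rule triangular_kernel_trivial[OF fin, of ?r ?T])
    show "wf ?r" by (intro wf_inv_image wf_lex_prod wf_less_than)
    show "?T a a \<noteq> 0" if "a \<in> I" for a
      using that piv by (auto simp: I_def V_def)
    show "?T a b = 0" if "a \<in> I" "b \<in> I" "a \<noteq> b" "(b, a) \<notin> ?r" for a b
    proof -
      obtain c j c' t where ab: "a = (c, j)" "b = (c', t)" by (cases a, cases b) auto
      then have "c < l" "j < n c" "c' < l" "t < n c'" using that by (auto simp: I_def)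
      then show ?thesis
        using that tri[of c' c] ab by (auto simp: V_def)
    qed
    show "(\<Sum>b\<in>I. ?T a b * w b) = 0" if "a \<in> I" for a
    proof -
      obtain c j where a: "a = (c, j)" by (cases a)
      then have "(c, n c - 1 - j) \<in> I" using that by (auto simp: I_def)
      from z0[OF this] show ?thesis
        by (simp add: z_def a case_prod_unfold)
    qed
  qed fact
qed

text \<open>Equal columns and linear dependences both yield kernel vectors. Independence concerns
  the set of columns, so distinctness is what makes its cardinality \<open>nc\<close>.\<close>

lemma rank_trivial_kernel:
  fixes A :: "real mat"
  assumes A: "A \<in> carrier_mat nr nc"
    and ker: "\<And>w. \<forall>x<nr. (\<Sum>c<nc. A $$ (x,c) * w c) = 0 \<Longrightarrow> \<forall>c<nc. w c = 0"
  shows "distinct (cols A)"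
    and "\<not> module.lin_dep class_ring (module_vec TYPE(real) nr) (set (cols A))"
    and "vec_space.rank nr A = nc"
proof -
  show dist: "distinct (cols A)"
    unfolding distinct_conv_nth
  proof (intro allI impI notI)
    fix i j assume "i < length (cols A)" "j < length (cols A)" "i \<noteq> j" "cols A ! i = cols A ! j"
    then have ij: "i < nc" "j < nc" "i \<noteq> j" "col A i = col A j" using A by auto
    \<comment> \<open>The difference of two unit vectors, in the kernel if columns \<open>i\<close>
      and \<open>j\<close> agree.\<close>
    let ?w = "\<lambda>c. (if c = i then 1 else 0) - (if c = j then 1 else 0) :: real"
    have "\<forall>x<nr. (\<Sum>c<nc. A $$ (x,c) * ?w c) = 0"
    proof (intro allI impI)
      fix x assume "x < nr"
      then have eq: "A $$ (x,i) = A $$ (x,j)"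
        using arg_cong[OF ij(4), of "\<lambda>w. w $ x"] A ij(1,2) by simp
      have \<delta>: "(\<Sum>c<nc. A $$ (x,c) * (if c = a then 1 else 0)) = A $$ (x,a)" if "a < nc" for a
      proof -
        have "(\<Sum>c<nc. A $$ (x,c) * (if c = a then 1 else 0)) = (\<Sum>c<nc. if c = a then A $$ (x,c) else 0)"
          by (rule sum.cong) auto
        then show ?thesis using that by simp
      qed
      show "(\<Sum>c<nc. A $$ (x,c) * ?w c) = 0"
        by (simp only: right_diff_distrib sum_subtractf \<delta>[OF ij(1)] \<delta>[OF ij(2)] eq diff_self)
    qed
    from ker[OF this] ij(1) have "?w i = 0" by blast
    then show False using ij(3) by simp
  qed
  interpret vec_space "TYPE(real)" nr .
  show ind: "lin_indpt (set (cols A))"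
  proof
    assume "lin_dep (set (cols A))"
    from lin_depE[OF A this dist] obtain w where
      w: "w \<in> carrier_vec nc" "w \<noteq> 0\<^sub>v nc" "A *\<^sub>v w = 0\<^sub>v nr" by blast
    have "(\<Sum>c<nc. A $$ (x,c) * w $ c) = 0" if "x < nr" for x
      using arg_cong[OF w(3), of "\<lambda>w. w $ x"] that A w(1)
      by (simp add: scalar_prod_def lessThan_atLeast0)
    with ker have "\<forall>c<nc. w $ c = 0" by blast
    then have "w = 0\<^sub>v nc" using w(1) by (intro eq_vecI) auto
    with w(2) show False ..
  qed
  show "rank A = nc" by (rule lin_indpt_full_rank[OF A dist ind])
qed

lemma rank_echelon_cols:
  fixes H :: "real mat"
  assumes H: "H \<in> carrier_mat k l"
    and piv: "\<And>c. c < l \<Longrightarrow> xs c < k \<and> H $$ (xs c, c) \<noteq> 0"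
    and tri: "\<And>c c'. c < c' \<Longrightarrow> c' < l \<Longrightarrow> H $$ (xs c, c') = 0"
  shows "vec_space.rank k H = l"
proof (rule rank_trivial_kernel(3)[OF H])
  fix w assume w: "\<forall>x<k. (\<Sum>c<l. H $$ (x,c) * w c) = 0"
  show "\<forall>c<l. w c = 0"
  proof (intro allI impI)
    fix c assume "c < l"
    show "w c = 0"
    proof (rule triangular_kernel_trivial[of "{..<l}" less_than "\<lambda>c c'. H $$ (xs c, c')"])
      show "H $$ (xs c, c') = 0" if "c' \<in> {..<l}" "c \<noteq> c'" "(c', c) \<notin> less_than" for c c'
        using that by (intro tri) auto
    qed (use piv w \<open>c < l\<close> in auto)
  qed
qed

text \<open>The pivot columns form a triangular square submatrix \<open>T\<close>, which provides
  \<open>l\<close> independent columns; more are impossible in dimension \<open>l\<close>.\<close>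

lemma rank_echelon_rows:
  fixes G :: "real mat"
  assumes G: "G \<in> carrier_mat l m"
    and piv: "\<And>c. c < l \<Longrightarrow> ys c < m \<and> G $$ (c, ys c) \<noteq> 0"
    and tri: "\<And>c c'. c < c' \<Longrightarrow> c' < l \<Longrightarrow> G $$ (c', ys c) = 0"
  shows "vec_space.rank l G = l"
proof -
  define T where "T = mat l l (\<lambda>(c,c'). G $$ (c, ys c'))"
  have T: "T \<in> carrier_mat l l" by (simp add: T_def)
  have "col T c = col G (ys c)" if "c < l" for c
    using G piv that by (intro eq_vecI) (auto simp: T_def)
  then have sub: "set (cols T) \<subseteq> set (cols G)"
    using G T piv by (fastforce simp: in_set_conv_nth)
  have ker: "\<forall>c<l. w c = 0" if w: "\<forall>x<l. (\<Sum>c<l. T $$ (x,c) * w c) = 0" for w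
  proof (intro allI impI)
    fix c assume "c < l"
    show "w c = 0"
    \<comment> \<open>Row \<open>c\<close> of \<open>T\<close> is zero before column
      \<open>c\<close>, so the unknowns are eliminated from the last one down.\<close>
    proof (rule triangular_kernel_trivial[of "{..<l}" "measure (\<lambda>c. l - c)" "\<lambda>c c'. T $$ (c, c')"])
      show "T $$ (c, c') = 0"
        if "c \<in> {..<l}" "c' \<in> {..<l}" "c \<noteq> c'" "(c', c) \<notin> measure (\<lambda>c. l - c)" for c c'
        using that tri[of c' c] by (auto simp: T_def)
      show "T $$ (c, c) \<noteq> 0" if "c \<in> {..<l}" for c
        using that piv by (simp add: T_def)
    qed (use w \<open>c < l\<close> in auto)
  qed
  interpret vec_space "TYPE(real)" l .
  have "card (set (cols T)) = l"
    using distinct_card[OF rank_trivial_kernel(1)[OF T ker]] T by simp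
  with rank_ge_card_indpt[OF G sub rank_trivial_kernel(2)[OF T ker]] have "l \<le> rank G" by simp
  moreover have "rank G \<le> l"
  proof -
    obtain S where S: "maximal S (\<lambda>T. T \<subseteq> set (cols G) \<and> lin_indpt T)" "finite S"
      using maximal_exists_superset[of "set (cols G)" "\<lambda>T. T \<subseteq> set (cols G) \<and> lin_indpt T" "set (cols T)"]
        sub rank_trivial_kernel(2)[OF T ker] by blast
    then have "rank G = card S" using rank_card_indpt[OF G] by blast
    moreover have "S \<subseteq> carrier_vec l" "lin_indpt S"
      using S(1) cols_dim[of G] G by (auto simp: maximal_def)
    ultimately show ?thesis using li_le_dim(2)[OF fin_dim, of S] dim_is_n by simp
  qed
  ultimately show ?thesis by simp
qed

section \<open>Nilpotent Jordan matrices\<close>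

lemma sum_offset_split:
  fixes f :: "nat \<Rightarrow> 'a::comm_monoid_add"
  shows "sum f {..<a + b} = sum f {..<a} + (\<Sum>i<b. f (a + i))"
  by (induction b) (simp_all add: add.assoc)

text \<open>The widths are a parameter because two layouts occur: \<open>d r\<close> for the rows of
  \<open>G_zero\<close> and columns of \<open>H_zero\<close>, and \<open>r * d r\<close> for the
  state space.\<close>

definition offset :: "nat \<Rightarrow> (nat \<Rightarrow> nat) \<Rightarrow> nat \<Rightarrow> nat" where
  "offset p w r = (\<Sum>r'\<in>{r<..p}. w r')"

lemma block_start_offset: "block_start p d r = offset p (\<lambda>r. r * d r) r"
  by (simp add: block_start_def offset_def)

lemma offset_same [simp]: "offset p w p = 0"
  by (simp add: offset_def)

lemma offset_Suc: "r \<le> p \<Longrightarrow> offset (Suc p) w r = w (Suc p) + offset p w r"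
proof -
  assume "r \<le> p"
  then have "{r<..Suc p} = insert (Suc p) {r<..p}" by auto
  then show ?thesis by (simp add: offset_def)
qed

lemma sum_offset:
  fixes f :: "nat \<Rightarrow> 'a::comm_monoid_add"
  shows "(\<Sum>s<(\<Sum>r=1..p. w r). f s) = (\<Sum>r=1..p. \<Sum>b<w r. f (offset p w r + b))"
proof (induction p arbitrary: f)
  case (Suc p)
  have "(\<Sum>s<(\<Sum>r=1..Suc p. w r). f s) = (\<Sum>s<w (Suc p) + (\<Sum>r=1..p. w r). f s)"
    by (simp add: add.commute)
  also have "\<dots> = (\<Sum>b<w (Suc p). f b) +
      (\<Sum>r=1..p. \<Sum>b<w r. f (w (Suc p) + (offset p w r + b)))"
    unfolding sum_offset_split Suc.IH ..
  also have "\<dots> = (\<Sum>r=1..Suc p. \<Sum>b<w r. f (offset (Suc p) w r + b))"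
    by (simp add: offset_Suc add.assoc add.commute[of _ "sum f _"])
  finally show ?case .
qed simp

lemma offset_less:
  assumes "r \<in> {1..p}" "b < w r"
  shows "offset p w r + b < (\<Sum>r=1..p. w r)"
proof -
  have "offset p w r + w r = sum w (insert r {r<..p})" by (simp add: offset_def)
  also have "\<dots> \<le> (\<Sum>r=1..p. w r)" using assms by (intro sum_mono2) auto
  finally show ?thesis using assms by simp
qed

lemma offset_surj:
  "s < (\<Sum>r=1..p. w r) \<Longrightarrow> \<exists>r\<in>{1..p}. \<exists>b<w r. s = offset p w r + b"
proof (induction p arbitrary: s)
  case (Suc p)
  show ?case
  proof (cases "s < w (Suc p)")
    case True
    then show ?thesis by (intro bexI[of _ "Suc p"] exI[of _ s]) auto
  next
    case False
    with Suc.prems have "s - w (Suc p) < (\<Sum>r=1..p. w r)" by simp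
    from Suc.IH[OF this] obtain r b where "r \<in> {1..p}" "b < w r" "s - w (Suc p) = offset p w r + b"
      by blast
    with False show ?thesis by (intro bexI[of _ r] exI[of _ b]) (auto simp: offset_Suc)
  qed
qed simp

text \<open>Lets a function on positions be prescribed by block and place within the block, without
  inverting the position map; the columns of \<open>H\<close> and rows of \<open>G\<close> are
  obtained in this way.\<close>

lemma offset_choice: "\<exists>f. \<forall>r\<in>{1..p}. \<forall>b<w r. f (offset p w r + b) = g r b"
proof (induction p)
  case (Suc p)
  then obtain f where f: "\<forall>r\<in>{1..p}. \<forall>b<w r. f (offset p w r + b) = g r b" by blast
  show ?case
    by (rule exI[of _ "\<lambda>s. if s < w (Suc p) then g (Suc p) s else f (s - w (Suc p))"])
      (use f in \<open>auto simp: le_Suc_eq offset_Suc\<close>)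
qed simp

lemma mult_mat_index_sum:
  assumes "A \<in> carrier_mat nr n" "B \<in> carrier_mat n nc" "i < nr" "j < nc"
  shows "(A * B) $$ (i, j) = (\<Sum>s<n. A $$ (i, s) * B $$ (s, j))"
  using assms by (simp add: scalar_prod_def lessThan_atLeast0)

lemma downclosed_eq_lessThan_card:
  fixes S :: "nat set"
  assumes "finite S" "\<And>a b. a \<in> S \<Longrightarrow> b < a \<Longrightarrow> b \<in> S"
  shows "S = {..<card S}"
proof (cases "S = {}")
  case False
  have "S = {..Max S}"
  proof
    show "{..Max S} \<subseteq> S"
      using assms(2)[OF Max_in[OF assms(1) False]] Max_in[OF assms(1) False]
      by (auto simp: le_less)
  qed (use assms in auto)
  then have "S = {..<Suc (Max S)}" by (simp add: lessThan_Suc_atMost)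
  then show ?thesis by (metis card_lessThan)
qed simp

text \<open>As \<open>n\<close> is non-increasing, the chains longer than \<open>r\<close> form an
  initial segment, of size \<open>offset p d r\<close>, and those of length at least
  \<open>r\<close> one that is longer by \<open>d r\<close>. Chains of length \<open>r\<close> are
  the difference.\<close>

lemma offset_multiplicities:
  fixes n :: "nat \<Rightarrow> nat"
  assumes anti: "\<And>c c'. c < c' \<Longrightarrow> c' < l \<Longrightarrow> n c' \<le> n c"
    and bnd: "\<And>c. c < l \<Longrightarrow> n c \<in> {1..p}"
  defines "d \<equiv> \<lambda>r. card {c. c < l \<and> n c = r}"
  shows "(\<Sum>r=1..p. d r) = l"
    and "\<And>r b. r \<in> {1..p} \<Longrightarrow> b < d r \<Longrightarrow> n (offset p d r + b) = r"
proof -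
  have union: "card {c. c < l \<and> n c \<in> A} = (\<Sum>r\<in>A. d r)" if "finite A" for A
  proof -
    have "{c. c < l \<and> n c \<in> A} = (\<Union>r\<in>A. {c. c < l \<and> n c = r})" by auto
    then show ?thesis using that unfolding d_def by (simp only:) (subst card_UN_disjoint; auto)
  qed
  have "{c. c < l \<and> n c \<in> {1..p}} = {..<l}" using bnd by auto
  with union[of "{1..p}"] show "(\<Sum>r=1..p. d r) = l" by simp
  fix r b assume r: "r \<in> {1..p}" and b: "b < d r"
  have gt: "{c. c < l \<and> r < n c} = {..<offset p d r}"
  proof -
    have "{c. c < l \<and> r < n c} = {c. c < l \<and> n c \<in> {r<..p}}" using bnd by auto
    moreover have "{c. c < l \<and> r < n c} = {..<card {c. c < l \<and> r < n c}}"
      by (rule downclosed_eq_lessThan_card) (use anti in \<open>auto intro: less_le_trans\<close>)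
    ultimately show ?thesis using union[of "{r<..p}"] by (simp add: offset_def)
  qed
  have ge: "{c. c < l \<and> r \<le> n c} = {..<offset p d r + d r}"
  proof -
    have "{c. c < l \<and> r \<le> n c} = {c. c < l \<and> n c \<in> insert r {r<..p}}" using bnd r by auto
    moreover have "{c. c < l \<and> r \<le> n c} = {..<card {c. c < l \<and> r \<le> n c}}"
      by (rule downclosed_eq_lessThan_card) (use anti in \<open>auto intro: le_trans\<close>)
    ultimately show ?thesis using union[of "insert r {r<..p}"] by (simp add: offset_def add.commute)
  qed
  have "offset p d r + b \<in> {..<offset p d r + d r}" using b by simp
  then have "r \<le> n (offset p d r + b)" "offset p d r + b < l" unfolding ge[symmetric] by auto
  moreover have "offset p d r + b \<notin> {..<offset p d r}" by simp
  ultimately show "n (offset p d r + b) = r" unfolding gt[symmetric] by auto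
qed

section \<open>The blocks K(r,d_r) and the powers of F\<close>

lemma K_block_carrier: "K_block r e \<in> carrier_mat (r * e) (r * e)"
  by (simp add: K_block_def kronecker_def jordan_block_def)

text \<open>Writing positions as \<open>a * e + b\<close>, the factor J_r raises \<open>a\<close> by
  one and the identity keeps \<open>b\<close>: the ones lie on the \<open>e\<close>-th
  superdiagonal.\<close>

lemma K_block_index:
  assumes "i < r * e" "j < r * e"
  shows "K_block r e $$ (i,j) = (if j = i + e then 1 else 0)"
proof -
  have e: "0 < e" using assms by (cases e) auto
  have "j = i + e \<longleftrightarrow> j div e = Suc (i div e) \<and> i mod e = j mod e"
  proof
    assume "j div e = Suc (i div e) \<and> i mod e = j mod e"
    then show "j = i + e"
      using div_mult_mod_eq[of j e] div_mult_mod_eq[of i e] by simp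
  qed (use e in simp)
  moreover have "i div e < r" "j div e < r" using assms by (simp_all add: less_mult_imp_div_less)
  ultimately show ?thesis
    using assms e by (simp add: K_block_def kronecker_def jordan_block_def)
qed

lemma rev_upt_Suc: "rev [1..<Suc (Suc p)] = Suc p # rev [1..<Suc p]"
  by simp

lemma nilpotent_jordan_0: "nilpotent_jordan 0 d = 0\<^sub>m 0 0"
  by (simp add: nilpotent_jordan_def)

lemma nilpotent_jordan_Suc:
  "nilpotent_jordan (Suc p) d = (let K = K_block (Suc p) (d (Suc p)); F = nilpotent_jordan p d in
    four_block_mat K (0\<^sub>m (dim_row K) (dim_col F)) (0\<^sub>m (dim_row F) (dim_col K)) F)"
  unfolding nilpotent_jordan_def rev_upt_Suc by (simp add: Let_def)

lemma nilpotent_jordan_carrier: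
  "nilpotent_jordan p d \<in> carrier_mat (\<Sum>r=1..p. r * d r) (\<Sum>r=1..p. r * d r)"
proof (induction p)
  case (Suc p)
  have "nilpotent_jordan (Suc p) d \<in>
      carrier_mat (Suc p * d (Suc p) + (\<Sum>r=1..p. r * d r)) (Suc p * d (Suc p) + (\<Sum>r=1..p. r * d r))"
    unfolding nilpotent_jordan_Suc Let_def by (rule four_block_carrier_mat[OF K_block_carrier Suc.IH])
  then show ?case by (simp add: add.commute)
qed (simp add: nilpotent_jordan_0)

lemma nilpotent_jordan_row:
  assumes "r \<in> {1..p}" "q < r * d r" "s < (\<Sum>r=1..p. r * d r)"
  shows "nilpotent_jordan p d $$ (offset p (\<lambda>r. r * d r) r + q, s) =
    (if q + d r < r * d r \<and> s = offset p (\<lambda>r. r * d r) r + (q + d r) then 1 else 0)"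
  using assms
proof (induction p arbitrary: s)
  case (Suc p)
  define w where "w = (\<lambda>r. r * d r)"
  let ?K = "K_block (Suc p) (d (Suc p))" and ?F = "nilpotent_jordan p d" and ?w = "w (Suc p)"
  have K: "?K \<in> carrier_mat ?w ?w" unfolding w_def by (rule K_block_carrier)
  have F: "?F \<in> carrier_mat (\<Sum>r=1..p. w r) (\<Sum>r=1..p. w r)"
    unfolding w_def by (rule nilpotent_jordan_carrier)
  have "nilpotent_jordan (Suc p) d =
      four_block_mat ?K (0\<^sub>m (dim_row ?K) (dim_col ?F)) (0\<^sub>m (dim_row ?F) (dim_col ?K)) ?F"
    unfolding nilpotent_jordan_Suc Let_def ..
  then have index: "nilpotent_jordan (Suc p) d $$ (i, s) =
      (if i < ?w then if s < ?w then ?K $$ (i, s) else 0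
       else if s < ?w then 0 else ?F $$ (i - ?w, s - ?w))"
    if "i < ?w + (\<Sum>r=1..p. w r)" for i
    using that Suc.prems(3) K F by (auto simp: w_def)
  show ?case
  proof (cases "r = Suc p")
    case True
    with Suc.prems have "q < ?w" by (simp add: w_def)
    then show ?thesis
      using index[of q] True K_block_index[of q "Suc p" "d (Suc p)" s] by (auto simp: w_def)
  next
    case False
    with Suc.prems have r: "r \<in> {1..p}" by auto
    from Suc.prems have q: "q < w r" by (simp add: w_def)
    have off: "offset (Suc p) w r = ?w + offset p w r" using r by (simp add: offset_Suc)
    have less: "offset p w r + q < (\<Sum>r=1..p. w r)" by (rule offset_less[where w = w, OF r q])
    have "nilpotent_jordan (Suc p) d $$ (offset (Suc p) w r + q, s) =
        (if s < ?w then 0 else ?F $$ (offset p w r + q, s - ?w))"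
      using index[of "offset (Suc p) w r + q"] less by (simp add: off)
    moreover have "?F $$ (offset p w r + q, s - ?w) =
        (if q + d r < r * d r \<and> s - ?w = offset p w r + (q + d r) then 1 else 0)" if "\<not> s < ?w"
      using Suc.IH[OF r, of "s - ?w"] Suc.prems that by (simp add: w_def)
    ultimately show ?thesis
      using off by (auto simp: w_def[symmetric])
  qed
qed simp

text \<open>Each factor F moves the rows of block \<open>r\<close> up by \<open>d r\<close> and
  fills the bottom with zeros. \<open>M\<close> varies in the induction because F^(t+1) M is read as
  F^t (F M).\<close>

lemma nilpotent_jordan_pow_mult_row:
  fixes d p
  defines "F \<equiv> nilpotent_jordan p d" and "n \<equiv> (\<Sum>r=1..p. r * d r)"
    and "off \<equiv> offset p (\<lambda>r. r * d r)"
  assumes r: "r \<in> {1..p}" and M: "M \<in> carrier_mat n m" and "y < m" and "q < r * d r"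
  shows "(F ^\<^sub>m t * M) $$ (off r + q, y) =
    (if q + t * d r < r * d r then M $$ (off r + (q + t * d r), y) else 0)"
  using M \<open>q < r * d r\<close>
proof (induction t arbitrary: M q)
  have F: "F \<in> carrier_mat n n" unfolding F_def n_def by (rule nilpotent_jordan_carrier)
  have lt: "off r + q < n" if "q < r * d r" for q
    unfolding off_def n_def by (rule offset_less[where w = "\<lambda>r. r * d r", OF r that])
  {
    case 0
    then show ?case using F lt by simp
  next
    case (Suc t)
    have step: "(F * M) $$ (off r + q', y) =
        (if q' + d r < r * d r then M $$ (off r + (q' + d r), y) else 0)" if "q' < r * d r" for q'
    proof -
      have "(F * M) $$ (off r + q', y) = (\<Sum>s<n. F $$ (off r + q', s) * M $$ (s, y))"
        by (rule mult_mat_index_sum[OF F Suc.prems(1) lt[OF that] \<open>y < m\<close>])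
      also have "\<dots> = (\<Sum>s<n. if s = off r + (q' + d r) then
          (if q' + d r < r * d r then M $$ (s, y) else 0) else 0)"
        using nilpotent_jordan_row[where d = d, OF r that] by (intro sum.cong) (auto simp: F_def n_def off_def)
      also have "\<dots> = (if q' + d r < r * d r then M $$ (off r + (q' + d r), y) else 0)"
        using lt[of "q' + d r"] by auto
      finally show ?thesis .
    qed
    have "F ^\<^sub>m Suc t * M = F ^\<^sub>m t * (F * M)"
      using assoc_mult_mat[OF pow_carrier_mat[OF F] F Suc.prems(1)] by simp
    then show ?case
      using Suc.IH[of "F * M" q] F Suc.prems step[of "q + t * d r"] by (auto simp: algebra_simps)
  }
qed

text \<open>Block \<open>r\<close> has width \<open>r * d r\<close>, at most \<open>p * d r\<close>,
  so \<open>p\<close> shifts by \<open>d r\<close> leave it. The shift rule is applied to the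
  identity matrix.\<close>

lemma nilpotent_jordan_pow_eq_0:
  fixes d p
  defines "n \<equiv> (\<Sum>r=1..p. r * d r)"
  shows "nilpotent_jordan p d ^\<^sub>m p = 0\<^sub>m n n"
proof (rule eq_matI)
  have F: "nilpotent_jordan p d \<in> carrier_mat n n" unfolding n_def by (rule nilpotent_jordan_carrier)
  then show "dim_row (nilpotent_jordan p d ^\<^sub>m p) = dim_row (0\<^sub>m n n :: real mat)"
    "dim_col (nilpotent_jordan p d ^\<^sub>m p) = dim_col (0\<^sub>m n n :: real mat)" by auto
  fix i j assume "i < dim_row (0\<^sub>m n n :: real mat)" "j < dim_col (0\<^sub>m n n :: real mat)"
  then have ij: "i < n" "j < n" by auto
  then obtain r q where r: "r \<in> {1..p}" "q < r * d r" "i = offset p (\<lambda>r. r * d r) r + q"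
    using offset_surj[of i "\<lambda>r. r * d r" p] unfolding n_def by blast
  have "r * d r \<le> p * d r" using r(1) by (intro mult_le_mono1) simp
  then have "\<not> q + p * d r < r * d r" by linarith
  then have "(nilpotent_jordan p d ^\<^sub>m p * 1\<^sub>m n) $$ (i, j) = 0"
    unfolding r(3) using nilpotent_jordan_pow_mult_row[OF r(1), of "1\<^sub>m n" d n j q p] ij(2) r(2)
    by (simp add: n_def)
  then show "(nilpotent_jordan p d ^\<^sub>m p) $$ (i, j) = 0\<^sub>m n n $$ (i, j)"
    using F ij right_mult_one_mat[OF pow_carrier_mat[OF F]] by simp
qed

lemma sum_blocks:
  fixes f :: "nat \<Rightarrow> 'a::comm_monoid_add"
  shows "(\<Sum>q<r * e. f q) = (\<Sum>a<r. \<Sum>b<e. f (a * e + b))"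
proof (induction r)
  case (Suc r)
  have "(\<Sum>q<Suc r * e. f q) = (\<Sum>q<r * e + e. f q)" by (simp add: add.commute)
  then show ?case unfolding sum_offset_split by (simp add: Suc.IH)
qed simp

text \<open>Chain \<open>b\<close> of block \<open>r\<close> occupies the positions
  \<open>a * d r + b\<close> with \<open>a < r\<close>, where \<open>H\<close> holds coefficient
  \<open>a\<close> of u and \<open>G\<close> coefficient \<open>r - 1 - a\<close> of v. Since F^t
  replaces \<open>a\<close> by \<open>a + t\<close> on the side of \<open>G\<close>, summing over
  \<open>a\<close> is a convolution.\<close>

lemma jordan_chain_markov:
  fixes u v :: "nat \<Rightarrow> nat \<Rightarrow> real fps" and d p
  defines "F \<equiv> nilpotent_jordan p d" and "n \<equiv> (\<Sum>r=1..p. r * d r)"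
    and "off \<equiv> offset p (\<lambda>r. r * d r)"
  assumes H: "H \<in> carrier_mat k n" and G: "G \<in> carrier_mat n m"
    and Hu: "\<And>r q x. r \<in> {1..p} \<Longrightarrow> q < r * d r \<Longrightarrow> x < k \<Longrightarrow>
      H $$ (x, off r + q) = fps_nth (u (offset p d r + q mod d r) x) (q div d r)"
    and Gv: "\<And>r q y. r \<in> {1..p} \<Longrightarrow> q < r * d r \<Longrightarrow> y < m \<Longrightarrow>
      G $$ (off r + q, y) = fps_nth (v (offset p d r + q mod d r) y) (r - 1 - q div d r)"
    and xy: "x < k" "y < m"
  shows "(H * F ^\<^sub>m t * G) $$ (x, y) = (\<Sum>r=1..p. \<Sum>b<d r.
    if t + 1 \<le> r then fps_nth (u (offset p d r + b) x * v (offset p d r + b) y) (r - (t + 1)) else 0)"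
proof -
  have F: "F \<in> carrier_mat n n" unfolding F_def n_def by (rule nilpotent_jordan_carrier)
  have FG: "F ^\<^sub>m t * G \<in> carrier_mat n m" using F G by auto
  have "(H * F ^\<^sub>m t * G) $$ (x, y) = (H * (F ^\<^sub>m t * G)) $$ (x, y)"
    using assoc_mult_mat[OF H pow_carrier_mat[OF F] G] by simp
  also have "\<dots> = (\<Sum>s<n. H $$ (x, s) * (F ^\<^sub>m t * G) $$ (s, y))"
    by (rule mult_mat_index_sum[OF H FG xy])
  also have "\<dots> = (\<Sum>r=1..p. \<Sum>q<r * d r. H $$ (x, off r + q) * (F ^\<^sub>m t * G) $$ (off r + q, y))"
    unfolding n_def off_def by (rule sum_offset)
  also have "\<dots> = (\<Sum>r=1..p. \<Sum>b<d r.
      if t + 1 \<le> r then fps_nth (u (offset p d r + b) x * v (offset p d r + b) y) (r - (t + 1)) else 0)"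
  proof (rule sum.cong[OF refl])
    fix r assume r: "r \<in> {1..p}"
    let ?u = "\<lambda>b. u (offset p d r + b) x" and ?v = "\<lambda>b. v (offset p d r + b) y"
    have entry: "H $$ (x, off r + (a * d r + b)) * (F ^\<^sub>m t * G) $$ (off r + (a * d r + b), y) =
        fps_nth (?u b) a * (if a + t < r then fps_nth (?v b) (r - 1 - t - a) else 0)"
      if "a < r" "b < d r" for a b
    proof -
      have lt: "i * d r + b < r * d r \<longleftrightarrow> i < r" for i
      proof
        assume "i < r"
        then have "Suc i * d r \<le> r * d r" by (intro mult_le_mono1) simp
        with \<open>b < d r\<close> show "i * d r + b < r * d r" by simp
      next
        assume "i * d r + b < r * d r"
        then have "i * d r < r * d r" by linarith
        then show "i < r" by simp
      qed
      have "(F ^\<^sub>m t * G) $$ (off r + (a * d r + b), y) =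
          (if (a + t) * d r + b < r * d r then G $$ (off r + ((a + t) * d r + b), y) else 0)"
        using nilpotent_jordan_pow_mult_row[OF r, of G d m y "a * d r + b" t] G xy(2) lt[of a] that
        by (simp add: F_def n_def off_def algebra_simps)
      also have "\<dots> = (if a + t < r then fps_nth (?v b) (r - 1 - t - a) else 0)"
        using Gv[OF r, of "(a + t) * d r + b" y] xy(2) lt[of "a + t"] that by (simp add: add.commute)
      finally show ?thesis
        using Hu[OF r, of "a * d r + b" x] xy(1) lt[of a] that by simp
    qed
    have "(\<Sum>q<r * d r. H $$ (x, off r + q) * (F ^\<^sub>m t * G) $$ (off r + q, y)) =
        (\<Sum>a<r. \<Sum>b<d r. fps_nth (?u b) a * (if a + t < r then fps_nth (?v b) (r - 1 - t - a) else 0))"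
      unfolding sum_blocks using entry by (intro sum.cong refl) auto
    also have "\<dots> = (\<Sum>b<d r. \<Sum>a<r.
        fps_nth (?u b) a * (if a + t < r then fps_nth (?v b) (r - 1 - t - a) else 0))"
      by (rule sum.swap)
    also have "\<dots> = (\<Sum>b<d r. if t + 1 \<le> r then fps_nth (?u b * ?v b) (r - (t + 1)) else 0)"
    proof -
      \<comment> \<open>The case of no shift on the side of \<open>f\<close>: all of F^t has been
        moved to \<open>G\<close>.\<close>
      have "(\<Sum>a<r. fps_nth f a * (if a + t < r then fps_nth g (r - 1 - t - a) else 0)) =
          (if t + 1 \<le> r then fps_nth (f * g) (r - (t + 1)) else 0)" for f g :: "real fps"
        using fps_mult_nth_shifted[of 0 t r f g] by (simp only: add_0 le0 if_True minus_nat.diff_0)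
      then show ?thesis by (simp only:)
    qed
    finally show "(\<Sum>q<r * d r. H $$ (x, off r + q) * (F ^\<^sub>m t * G) $$ (off r + q, y)) =
        (\<Sum>b<d r. if t + 1 \<le> r then fps_nth (?u b * ?v b) (r - (t + 1)) else 0)" .
  qed
  finally show ?thesis .
qed

section \<open>The stacked blocks with second index 0\<close>

lemma stack_rows:
  assumes "\<forall>r\<in>{1..p}. B r \<in> carrier_mat (w r) m"
  shows "foldr append_rows (map B (rev [1..<Suc p])) (0\<^sub>m 0 m) \<in> carrier_mat (\<Sum>r=1..p. w r) m \<and>
    (\<forall>r\<in>{1..p}. \<forall>b<w r. \<forall>y<m.
      foldr append_rows (map B (rev [1..<Suc p])) (0\<^sub>m 0 m) $$ (offset p w r + b, y) = B r $$ (b, y))"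
  using assms
proof (induction p)
  case (Suc p)
  define M where "M = foldr append_rows (map B (rev [1..<Suc p])) (0\<^sub>m 0 m)"
  have IH: "M \<in> carrier_mat (\<Sum>r=1..p. w r) m"
    "\<And>r b y. r \<in> {1..p} \<Longrightarrow> b < w r \<Longrightarrow> y < m \<Longrightarrow> M $$ (offset p w r + b, y) = B r $$ (b, y)"
    using Suc unfolding M_def by auto
  have B: "B (Suc p) \<in> carrier_mat (w (Suc p)) m" using Suc.prems by auto
  have eq: "foldr append_rows (map B (rev [1..<Suc (Suc p)])) (0\<^sub>m 0 m) = B (Suc p) @\<^sub>r M"
    unfolding rev_upt_Suc M_def by simp
  have "B (Suc p) @\<^sub>r M \<in> carrier_mat (w (Suc p) + (\<Sum>r=1..p. w r)) m"
    using B IH(1) by (rule carrier_append_rows)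
  moreover have "(B (Suc p) @\<^sub>r M) $$ (offset (Suc p) w r + b, y) = B r $$ (b, y)"
    if "r \<in> {1..Suc p}" "b < w r" "y < m" for r b y
  proof (cases "r = Suc p")
    case True
    then show ?thesis using that B IH(1) by (simp add: append_rows_def)
  next
    case False
    with that have r: "r \<in> {1..p}" by auto
    then show ?thesis
      using that B IH offset_less[OF r, of b w] by (simp add: append_rows_def offset_Suc)
  qed
  ultimately show ?case unfolding eq by (simp add: add.commute)
qed simp

lemma stack_cols:
  assumes "\<forall>r\<in>{1..p}. B r \<in> carrier_mat k (w r)"
  shows "foldr append_cols (map B (rev [1..<Suc p])) (0\<^sub>m k 0) \<in> carrier_mat k (\<Sum>r=1..p. w r) \<and>
    (\<forall>r\<in>{1..p}. \<forall>b<w r. \<forall>x<k.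
      foldr append_cols (map B (rev [1..<Suc p])) (0\<^sub>m k 0) $$ (x, offset p w r + b) = B r $$ (x, b))"
  using assms
proof (induction p)
  case (Suc p)
  define M where "M = foldr append_cols (map B (rev [1..<Suc p])) (0\<^sub>m k 0)"
  have IH: "M \<in> carrier_mat k (\<Sum>r=1..p. w r)"
    "\<And>r b x. r \<in> {1..p} \<Longrightarrow> b < w r \<Longrightarrow> x < k \<Longrightarrow> M $$ (x, offset p w r + b) = B r $$ (x, b)"
    using Suc unfolding M_def by auto
  have B: "B (Suc p) \<in> carrier_mat k (w (Suc p))" using Suc.prems by auto
  have eq: "foldr append_cols (map B (rev [1..<Suc (Suc p)])) (0\<^sub>m k 0) = append_cols (B (Suc p)) M"
    unfolding rev_upt_Suc M_def by simp
  have "append_cols (B (Suc p)) M \<in> carrier_mat k (w (Suc p) + (\<Sum>r=1..p. w r))"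
    using B IH(1) by (auto simp: append_cols_def)
  moreover have "append_cols (B (Suc p)) M $$ (x, offset (Suc p) w r + b) = B r $$ (x, b)"
    if "r \<in> {1..Suc p}" "b < w r" "x < k" for r b x
  proof (cases "r = Suc p")
    case True
    then show ?thesis using that B IH(1) by (simp add: append_cols_def)
  next
    case False
    with that have r: "r \<in> {1..p}" by auto
    then show ?thesis
      using that B IH offset_less[OF r, of b w] by (simp add: append_cols_def offset_Suc)
  qed
  ultimately show ?case unfolding eq by (simp add: add.commute)
qed simp

lemma G_zero_carrier: "G_zero p d G \<in> carrier_mat (\<Sum>r=1..p. d r) (dim_col G)"
  unfolding G_zero_def using stack_rows[of p "\<lambda>r. G_block p d G r 0" d "dim_col G"]
  by (simp add: G_block_def)

text \<open>In \<open>G\<close> the second index descends, so the block with \<open>j = 0\<close> is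
  the last of its group, after \<open>(r - 1) * d r\<close> rows; in \<open>H\<close> it is the
  first.\<close>

lemma G_zero_index:
  assumes "r \<in> {1..p}" "b < d r" "y < dim_col G"
  shows "G_zero p d G $$ (offset p d r + b, y) =
    G $$ (offset p (\<lambda>r. r * d r) r + ((r - 1) * d r + b), y)"
  unfolding G_zero_def using stack_rows[of p "\<lambda>r. G_block p d G r 0" d "dim_col G"] assms
  by (simp add: G_block_def block_start_offset add.assoc)

lemma H_zero_carrier: "H_zero p d H \<in> carrier_mat (dim_row H) (\<Sum>r=1..p. d r)"
  unfolding H_zero_def using stack_cols[of p "\<lambda>r. H_block p d H r 0" "dim_row H" d]
  by (simp add: H_block_def)

lemma H_zero_index:
  assumes "r \<in> {1..p}" "b < d r" "x < dim_row H"
  shows "H_zero p d H $$ (x, offset p d r + b) = H $$ (x, offset p (\<lambda>r. r * d r) r + b)"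
  unfolding H_zero_def using stack_cols[of p "\<lambda>r. H_block p d H r 0" "dim_row H" d] assms
  by (simp add: H_block_def block_start_offset)

section \<open>Realizations over the rational functions\<close>

text \<open>A right inverse of a square matrix over a field is two-sided, so
  \<open>mat_inverse\<close> succeeds, and its result \<open>C\<close> satisfies C = C (A B) =
  B.\<close>

lemma mat_inverse_eqI:
  fixes A :: "'a::field mat"
  assumes A: "A \<in> carrier_mat n n" and B: "B \<in> carrier_mat n n" and AB: "A * B = 1\<^sub>m n"
  shows "mat_inverse A = Some B"
proof (cases "mat_inverse A")
  case None
  have "A \<in> Units (ring_mat TYPE('a) n ())"
    using A B AB mat_mult_left_right_inverse[OF A B AB]
    by (auto simp: Units_def ring_mat_def intro!: bexI[of _ B])
  with mat_inverse(1)[OF A None, of "()"] show ?thesis by blast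
next
  case (Some C)
  note C = mat_inverse(2)[OF A Some]
  have "C = C * (A * B)" using AB C right_mult_one_mat[of C n n] by simp
  also have "\<dots> = (C * A) * B" using A B C by (intro assoc_mult_mat[symmetric]) auto
  finally show ?thesis using B C Some by simp
qed

lemma const_hom: "comm_ring_hom (\<lambda>c::real. to_fract [:c:])"
proof
  fix x y :: real
  show "to_fract [:x * y:] = to_fract [:x:] * to_fract [:y:]"
    by (subst to_fract_mult[symmetric]) simp
  show "to_fract [:x + y:] = to_fract [:x:] + to_fract [:y:]"
    by (subst to_fract_add[symmetric]) simp
qed (simp_all add: pCons_one)

lemma const_mat_mult:
  "A \<in> carrier_mat nr n \<Longrightarrow> B \<in> carrier_mat n nc \<Longrightarrow> const_mat (A * B) = const_mat A * const_mat B"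
  unfolding const_mat_def
  by (rule semiring_hom.mat_hom_mult[OF ring_hom.axioms(1)[OF comm_ring_hom.axioms(1)[OF const_hom]]])

lemma const_mat_pow:
  "A \<in> carrier_mat n n \<Longrightarrow> const_mat (A ^\<^sub>m t) = const_mat A ^\<^sub>m t"
  unfolding const_mat_def
  by (rule semiring_hom.mat_hom_pow[OF ring_hom.axioms(1)[OF comm_ring_hom.axioms(1)[OF const_hom]]])

lemma smult_smult_mat: "a \<cdot>\<^sub>m (b \<cdot>\<^sub>m A) = (a * b) \<cdot>\<^sub>m (A :: 'a::semigroup_mult mat)"
  by (intro eq_matI) (auto simp: mult.assoc)

lemma pow_mat_commute:
  assumes "A \<in> carrier_mat n n"
  shows "A * A ^\<^sub>m t = A ^\<^sub>m t * A"
proof (induction t)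
  case (Suc t)
  have "A * A ^\<^sub>m Suc t = A * A ^\<^sub>m t * A"
    using assoc_mult_mat[OF assms pow_carrier_mat[OF assms, of t] assms] by simp
  then show ?case unfolding Suc.IH by simp
qed (use assms in simp)

lemma const_mat_carrier [simp]: "const_mat A \<in> carrier_mat n m \<longleftrightarrow> A \<in> carrier_mat n m"
  unfolding const_mat_def by (rule map_carrier_mat)

lemma pow_mat_smult:
  fixes A :: "'a::comm_semiring_1 mat"
  assumes A: "A \<in> carrier_mat n n"
  shows "(a \<cdot>\<^sub>m A) ^\<^sub>m t = a ^ t \<cdot>\<^sub>m (A ^\<^sub>m t)"
proof (induction t)
  case 0
  show ?case using A by (intro eq_matI) auto
next
  case (Suc t)
  have "(a \<cdot>\<^sub>m A) ^\<^sub>m Suc t = (a ^ t \<cdot>\<^sub>m (A ^\<^sub>m t)) * (a \<cdot>\<^sub>m A)" by (simp add: Suc.IH)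
  also have "\<dots> = a \<cdot>\<^sub>m ((a ^ t \<cdot>\<^sub>m (A ^\<^sub>m t)) * A)"
    by (rule mult_smult_distrib[OF smult_carrier_mat[OF pow_carrier_mat[OF A]] A])
  also have "\<dots> = a \<cdot>\<^sub>m (a ^ t \<cdot>\<^sub>m (A ^\<^sub>m t * A))"
    by (simp add: mult_smult_assoc_mat[OF pow_carrier_mat[OF A] A])
  finally show ?case by (simp add: smult_smult_mat)
qed

text \<open>\<open>S\<close> is the geometric sum of N^t for \<open>t < p\<close>; multiplying it by
  I - N telescopes. It is built by induction together with its value between \<open>H\<close> and
  \<open>G\<close>.\<close>

lemma neumann_partial_sum:
  fixes H F G :: "real mat"
  assumes H: "H \<in> carrier_mat k n" and F: "F \<in> carrier_mat n n" and G: "G \<in> carrier_mat n m"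
  defines "N \<equiv> lag \<cdot>\<^sub>m const_mat F"
  shows "\<exists>S \<in> carrier_mat n n. (1\<^sub>m n - N) * S = 1\<^sub>m n - N ^\<^sub>m p \<and>
    const_mat H * S * const_mat G =
      sum_of_mats k m (\<lambda>t. lag ^ t \<cdot>\<^sub>m const_mat (H * F ^\<^sub>m t * G)) {..<p}"
proof (induction p)
  case 0
  have "(1\<^sub>m n - N) * 0\<^sub>m n n = 1\<^sub>m n - N ^\<^sub>m 0"
    using F by (subst right_mult_zero_mat[of _ n]) (auto simp: N_def const_mat_def)
  moreover have "const_mat H * 0\<^sub>m n n * const_mat G = 0\<^sub>m k m"
    using H G by (subst right_mult_zero_mat[of _ k]) (auto intro!: left_mult_zero_mat)
  moreover have "0\<^sub>m k m = sum_of_mats k m (\<lambda>t. lag ^ t \<cdot>\<^sub>m const_mat (H * F ^\<^sub>m t * G)) {..<0}"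
    by (intro eq_matI) (auto simp: sum_of_mats_def)
  ultimately show ?case by (intro bexI[of _ "0\<^sub>m n n"]) auto
next
  case (Suc p)
  have N: "N \<in> carrier_mat n n" using F by (simp add: N_def)
  then have Np: "N ^\<^sub>m p \<in> carrier_mat n n" by simp
  have Fp: "F ^\<^sub>m p \<in> carrier_mat n n" using F by simp
  have cH: "const_mat H \<in> carrier_mat k n" and cG: "const_mat G \<in> carrier_mat n m"
    using H G by auto
  from Suc obtain S where S: "S \<in> carrier_mat n n" "(1\<^sub>m n - N) * S = 1\<^sub>m n - N ^\<^sub>m p"
    "const_mat H * S * const_mat G =
      sum_of_mats k m (\<lambda>t. lag ^ t \<cdot>\<^sub>m const_mat (H * F ^\<^sub>m t * G)) {..<p}" by blast
  \<comment> \<open>The recursion for matrix powers multiplies on the right, whereas I - N acts from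
    the left.\<close>
  have comm: "N * N ^\<^sub>m p = N ^\<^sub>m p * N"
    by (rule pow_mat_commute[OF N])
  have 1: "(1\<^sub>m n - N) * (S + N ^\<^sub>m p) = 1\<^sub>m n - N ^\<^sub>m Suc p"
  proof -
    have "(1\<^sub>m n - N) * (S + N ^\<^sub>m p) = (1\<^sub>m n - N) * S + (1\<^sub>m n - N) * N ^\<^sub>m p"
      using N Np S by (intro mult_add_distrib_mat[of _ n n]) auto
    also have "(1\<^sub>m n - N) * N ^\<^sub>m p = N ^\<^sub>m p - N ^\<^sub>m p * N"
      using N Np by (subst minus_mult_distrib_mat[of _ n n]) (auto simp: comm)
    also have "(1\<^sub>m n - N) * S + (N ^\<^sub>m p - N ^\<^sub>m p * N) = 1\<^sub>m n - N ^\<^sub>m Suc p"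
      unfolding S(2) using N Np by (intro eq_matI) auto
    finally show ?thesis .
  qed
  have last: "const_mat H * N ^\<^sub>m p * const_mat G = lag ^ p \<cdot>\<^sub>m const_mat (H * F ^\<^sub>m p * G)"
  proof -
    have "N ^\<^sub>m p = lag ^ p \<cdot>\<^sub>m const_mat (F ^\<^sub>m p)"
      using F unfolding N_def by (simp add: pow_mat_smult[of _ n] const_mat_pow)
    then show ?thesis
      using H Fp G
      by (simp add: mult_smult_distrib[of _ k n _ n] mult_smult_assoc_mat[of _ k n _ m]
          const_mat_mult[of _ k n _ n] const_mat_mult[of _ n n _ m] const_mat_mult[of _ k n _ m])
  qed
  have "const_mat H * (S + N ^\<^sub>m p) * const_mat G =
      const_mat H * S * const_mat G + const_mat H * N ^\<^sub>m p * const_mat G"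
    using cH cG S Np by (simp add: mult_add_distrib_mat[of _ k n _ n] add_mult_distrib_mat[of _ k n _ _ m])
  also have "\<dots> = sum_of_mats k m (\<lambda>t. lag ^ t \<cdot>\<^sub>m const_mat (H * F ^\<^sub>m t * G)) {..<Suc p}"
    unfolding S(3) last using H Fp G
    by (intro eq_matI) (auto simp: sum_of_mats_def const_mat_def add.commute)
  finally show ?case using 1 S Np by (intro bexI[of _ "S + N ^\<^sub>m p"]) auto
qed

lemma s_var_neq_0: "s_var \<noteq> 0"
  by (simp add: s_var_def)

lemma lag_polynomial_eq_transfer_matrix: "lag_polynomial k m p \<Phi> = transfer_matrix k m p \<Phi>"
  unfolding lag_polynomial_def transfer_matrix_def lag_def ..

text \<open>Nilpotency makes the finite Neumann sum an exact inverse of I - FL, and sI - F = s(I -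
  FL) then has the inverse L times that sum.\<close>

lemma nilpotent_realization:
  fixes H F G :: "real mat"
  assumes H: "H \<in> carrier_mat k n" and F: "F \<in> carrier_mat n n" and G: "G \<in> carrier_mat n m"
    and nil: "F ^\<^sub>m p = 0\<^sub>m n n"
    and \<Phi>: "\<And>i. i \<in> {1..p} \<Longrightarrow> \<Phi> i = H * F ^\<^sub>m (i - 1) * G"
  shows "realization H F G (transfer_matrix k m p \<Phi>)"
    and "lag_representation H F G (lag_polynomial k m p \<Phi>)"
proof -
  define N where "N = lag \<cdot>\<^sub>m const_mat F"
  have N: "N \<in> carrier_mat n n" using F by (simp add: N_def)
  from neumann_partial_sum[OF H F G, of p] obtain S where S: "S \<in> carrier_mat n n"
      "(1\<^sub>m n - N) * S = 1\<^sub>m n - N ^\<^sub>m p"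
      "const_mat H * S * const_mat G =
        sum_of_mats k m (\<lambda>t. lag ^ t \<cdot>\<^sub>m const_mat (H * F ^\<^sub>m t * G)) {..<p}"
    unfolding N_def by blast
  have "N ^\<^sub>m p = lag ^ p \<cdot>\<^sub>m const_mat (F ^\<^sub>m p)"
    using F unfolding N_def by (simp add: pow_mat_smult[of _ n] const_mat_pow)
  then have "N ^\<^sub>m p = 0\<^sub>m n n"
    unfolding nil by (auto simp: const_mat_def intro!: eq_matI)
  then have inv: "(1\<^sub>m n - N) * S = 1\<^sub>m n" using S(2) by (auto intro!: eq_matI)
  have Z: "transfer_matrix k m p \<Phi> = lag \<cdot>\<^sub>m (const_mat H * S * const_mat G)"
  proof -
    \<comment> \<open>The extra factor L raises the exponent \<open>t\<close> to
      \<open>t + 1\<close>, which pairs the coefficient of index \<open>i\<close> with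
      F^(i-1).\<close>
    have "lag \<cdot>\<^sub>m (const_mat H * S * const_mat G) =
        mat k m (\<lambda>ij. \<Sum>t<p. lag ^ Suc t * to_fract [:(H * F ^\<^sub>m t * G) $$ ij:])"
      unfolding S(3) using H F G
      by (intro eq_matI) (auto simp: sum_of_mats_def const_mat_def sum_distrib_left mult.assoc)
    also have "\<dots> = transfer_matrix k m p \<Phi>"
      unfolding transfer_matrix_def sum_of_mats_def
    proof (rule cong_mat[OF refl refl])
      fix i j assume "i < k" "j < m"
      have "(\<Sum>r=1..p. (inverse s_var ^ r \<cdot>\<^sub>m const_mat (\<Phi> r)) $$ (i,j)) =
          (\<Sum>r=1..p. lag ^ r * to_fract [:(H * F ^\<^sub>m (r - 1) * G) $$ (i,j):])"
        using H F G \<open>i < k\<close> \<open>j < m\<close> by (intro sum.cong) (auto simp: \<Phi> lag_def const_mat_def)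
      also have "\<dots> = (\<Sum>t<p. lag ^ Suc t * to_fract [:(H * F ^\<^sub>m t * G) $$ (i,j):])"
        by (simp add: sum.atLeast1_atMost_eq)
      finally show "(\<Sum>t<p. lag ^ Suc t * to_fract [:(H * F ^\<^sub>m t * G) $$ (i,j):]) =
          (\<Sum>r=1..p. (inverse s_var ^ r \<cdot>\<^sub>m const_mat (\<Phi> r)) $$ (i,j))" ..
    qed
    finally show ?thesis ..
  qed
  have dims: "dim_row F = n" using F by simp
  show "lag_representation H F G (lag_polynomial k m p \<Phi>)"
    unfolding lag_representation_def dims lag_polynomial_eq_transfer_matrix Z
    by (rule exI[of _ S]) (use inv N S in \<open>auto simp flip: N_def intro!: mat_inverse_eqI[of _ n]\<close>)
  have "(s_var \<cdot>\<^sub>m 1\<^sub>m n - const_mat F) = s_var \<cdot>\<^sub>m (1\<^sub>m n - N)"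
    using F s_var_neq_0
    by (intro eq_matI) (auto simp: N_def lag_def const_mat_def right_diff_distrib field_simps)
  moreover have "s_var \<cdot>\<^sub>m (1\<^sub>m n - N) * (lag \<cdot>\<^sub>m S) = s_var * lag \<cdot>\<^sub>m ((1\<^sub>m n - N) * S)"
    using mult_smult_distrib[of "s_var \<cdot>\<^sub>m (1\<^sub>m n - N)" n n S n lag]
      mult_smult_assoc_mat[of "1\<^sub>m n - N" n n S n s_var]
      minus_carrier_mat[OF N, of "1\<^sub>m n"] S(1)
    by (simp add: smult_smult_mat mult.commute)
  ultimately have "(s_var \<cdot>\<^sub>m 1\<^sub>m n - const_mat F) * (lag \<cdot>\<^sub>m S) = 1\<^sub>m n"
    unfolding inv using s_var_neq_0 by (simp add: lag_def) (auto intro!: eq_matI)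
  then have R: "mat_inverse (s_var \<cdot>\<^sub>m 1\<^sub>m n - const_mat F) = Some (lag \<cdot>\<^sub>m S)"
    using F S by (intro mat_inverse_eqI[of _ n]) auto
  have "const_mat H * (lag \<cdot>\<^sub>m S) * const_mat G = lag \<cdot>\<^sub>m (const_mat H * S * const_mat G)"
    using H S G by (simp add: mult_smult_distrib[of _ k n _ n] mult_smult_assoc_mat[of _ k n _ m])
  with R show "realization H F G (transfer_matrix k m p \<Phi>)"
    unfolding realization_def dims
    using H F G by (auto simp: Z)
qed

section \<open>Polynomial combinations of columns of a transfer matrix\<close>

lemma s_var_pow: "s_var ^ t = to_fract (monom 1 t)"
proof (induction t)
  case (Suc t)
  have "s_var ^ Suc t = s_var * to_fract (monom 1 t)" by (simp add: Suc.IH)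
  also have "\<dots> = to_fract ([:0, 1:] * monom 1 t)" by (simp only: s_var_def to_fract_mult)
  finally show ?case by (simp add: monom_Suc)
qed simp

lemma const_add: "to_fract [:a + b:] = to_fract [:a:] + to_fract [:b::real:]"
  by (subst to_fract_add[symmetric]) simp

lemma const_mult: "to_fract [:a * b:] = to_fract [:a:] * to_fract [:b::real:]"
  by (subst to_fract_mult[symmetric]) simp

lemma const_sum: "to_fract [:\<Sum>i\<in>I. f i:] = (\<Sum>i\<in>I. to_fract [:f i :: real:])"
  by (induction I rule: infinite_finite_induct)
    (simp_all only: const_add sum.infinite sum.empty sum.insert pCons_0_0 to_fract_0
      not_False_eq_True if_False)

text \<open>From \<open>R (s I - F) = I\<close> one gets \<open>s R = I + R F\<close>, hence \<open>s\<^sup>t R g = P + R F\<^sup>t g\<close> with a polynomial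
  vector \<open>P\<close>. A kernel vector \<open>w\<close> of the \<open>F\<^sup>t g\<close> therefore makes \<open>\<Sum>w s\<^sup>t R g\<close> polynomial.\<close>

lemma realization_polynomial_combination:
  assumes real: "realization H F G Z" and fin: "finite I" and card: "dim_row F < card I"
    and yy: "\<And>e. e \<in> I \<Longrightarrow> yy e < dim_col Z"
  shows "\<exists>w. (\<exists>e\<in>I. w e \<noteq> 0) \<and> (\<forall>x<dim_row Z. \<exists>P.
    (\<Sum>e\<in>I. to_fract [:w e:] * s_var ^ tt e * Z $$ (x, yy e)) = to_fract P)"
proof -
  define N where "N = dim_row F"
  from real obtain R where F: "F \<in> carrier_mat N N" and H: "H \<in> carrier_mat (dim_row Z) N"
    and G: "G \<in> carrier_mat N (dim_col Z)"
    and R: "mat_inverse (s_var \<cdot>\<^sub>m 1\<^sub>m N - const_mat F) = Some R"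
    and Z: "Z = const_mat H * R * const_mat G"
    unfolding realization_def N_def by blast
  have sF: "s_var \<cdot>\<^sub>m 1\<^sub>m N - const_mat F \<in> carrier_mat N N"
    using F by (intro minus_carrier_mat) simp
  note inv = mat_inverse(2)[OF sF R]
  then have Rc: "R \<in> carrier_mat N N" by blast
  have cH: "const_mat H \<in> carrier_mat (dim_row Z) N" and cG: "const_mat G \<in> carrier_mat N (dim_col Z)"
    using H G by auto
  let ?c = "\<lambda>a::real. to_fract [:a:]"
  \<comment> \<open>\<open>\<rho> g\<close> is the vector R g for a real vector \<open>g\<close>,
    and \<open>step g\<close> is F g.\<close>
  define \<rho> where "\<rho> g i = (\<Sum>j<N. R $$ (i, j) * ?c (g j))" for g i
  define step where "step g j = (\<Sum>l<N. F $$ (j, l) * g l)" for g :: "nat \<Rightarrow> real" and j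
  have sR: "s_var * R $$ (i, j) = (if i = j then 1 else 0) + (\<Sum>l<N. R $$ (i, l) * ?c (F $$ (l, j)))"
    if "i < N" "j < N" for i j
  proof -
    have "(R * (s_var \<cdot>\<^sub>m 1\<^sub>m N - const_mat F)) $$ (i, j) = (if i = j then 1 else 0)"
      using inv that by simp
    moreover have "(R * (s_var \<cdot>\<^sub>m 1\<^sub>m N - const_mat F)) $$ (i, j) =
        (\<Sum>l<N. R $$ (i, l) * ((if l = j then s_var else 0) - ?c (F $$ (l, j))))"
      unfolding mult_mat_index_sum[OF Rc sF that]
      using F that by (intro sum.cong) (auto simp: const_mat_def)
    moreover have "\<dots> = (\<Sum>l<N. if l = j then R $$ (i, l) * s_var else 0) -
        (\<Sum>l<N. R $$ (i, l) * ?c (F $$ (l, j)))"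
      unfolding sum_subtractf[symmetric] by (rule sum.cong) (auto simp: right_diff_distrib)
    ultimately show ?thesis using that by (simp add: mult.commute)
  qed
  have s\<rho>: "s_var * \<rho> g i = ?c (g i) + \<rho> (step g) i" if "i < N" for g i
  proof -
    have "s_var * \<rho> g i = (\<Sum>j<N. (s_var * R $$ (i, j)) * ?c (g j))"
      by (simp add: \<rho>_def sum_distrib_left mult.assoc)
    also have "\<dots> = (\<Sum>j<N. (if j = i then ?c (g j) else 0) +
        (\<Sum>l<N. R $$ (i, l) * ?c (F $$ (l, j) * g j)))"
      using that by (intro sum.cong)
        (auto simp: sR distrib_right sum_distrib_right mult.assoc simp flip: const_mult)
    also have "\<dots> = ?c (g i) + (\<Sum>j<N. \<Sum>l<N. R $$ (i, l) * ?c (F $$ (l, j) * g j))"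
      using that by (simp add: sum.distrib)
    also have "(\<Sum>j<N. \<Sum>l<N. R $$ (i, l) * ?c (F $$ (l, j) * g j)) = \<rho> (step g) i"
      unfolding \<rho>_def step_def const_sum sum_distrib_left by (rule sum.swap)
    finally show ?thesis .
  qed
  have iter: "\<exists>P. s_var ^ t * \<rho> g i = to_fract P + \<rho> ((step ^^ t) g) i" if "i < N" for t g i
  proof (induction t)
    case 0
    show ?case by (rule exI[of _ 0]) simp
  next
    case (Suc t)
    then obtain P where P: "s_var ^ t * \<rho> g i = to_fract P + \<rho> ((step ^^ t) g) i" by blast
    have "s_var ^ Suc t * \<rho> g i = s_var * (s_var ^ t * \<rho> g i)" by simp
    also have "\<dots> = s_var * to_fract P + (?c ((step ^^ t) g i) + \<rho> ((step ^^ Suc t) g) i)"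
      unfolding P distrib_left s\<rho>[OF that] by simp
    also have "\<dots> = to_fract ([:0, 1:] * P + [:(step ^^ t) g i:]) + \<rho> ((step ^^ Suc t) g) i"
      unfolding to_fract_add to_fract_mult s_var_def by (simp only: add.assoc)
    finally show ?case by blast
  qed
  define gc where "gc e j = G $$ (j, yy e)" for e j
  define q where "q e = (step ^^ tt e) (gc e)" for e
  \<comment> \<open>The vectors F^t g live in dimension \<open>N\<close>, which is below the number
    of indices \<open>e\<close>; hence a nontrivial relation \<open>w\<close>.\<close>
  from nontrivial_kernel[OF fin card[folded N_def], of q] obtain w where
    w: "\<exists>e\<in>I. w e \<noteq> 0" "\<And>j. j < N \<Longrightarrow> (\<Sum>e\<in>I. w e * q e j) = 0" by blast
  have poly: "\<exists>P. (\<Sum>e\<in>I. ?c (w e) * (s_var ^ tt e * \<rho> (gc e) i)) = to_fract P" if "i < N" for i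
  proof -
    from iter[OF that] have "\<forall>e. \<exists>P. s_var ^ tt e * \<rho> (gc e) i = to_fract P + \<rho> (q e) i"
      unfolding q_def by blast
    then obtain P where P: "\<And>e. s_var ^ tt e * \<rho> (gc e) i = to_fract (P e) + \<rho> (q e) i" by metis
    have "(\<Sum>e\<in>I. ?c (w e) * \<rho> (q e) i) = (\<Sum>e\<in>I. \<Sum>j<N. R $$ (i, j) * ?c (w e * q e j))"
      unfolding \<rho>_def sum_distrib_left const_mult by (simp only: mult.left_commute)
    also have "\<dots> = (\<Sum>j<N. \<Sum>e\<in>I. R $$ (i, j) * ?c (w e * q e j))"
      by (rule sum.swap)
    also have "\<dots> = (\<Sum>j<N. R $$ (i, j) * ?c (\<Sum>e\<in>I. w e * q e j))"
      unfolding const_sum sum_distrib_left ..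
    also have "\<dots> = 0" by (rule sum.neutral) (simp add: w(2))
    finally have 0: "(\<Sum>e\<in>I. ?c (w e) * \<rho> (q e) i) = 0" .
    have "(\<Sum>e\<in>I. ?c (w e) * (s_var ^ tt e * \<rho> (gc e) i)) =
        (\<Sum>e\<in>I. ?c (w e) * to_fract (P e)) + (\<Sum>e\<in>I. ?c (w e) * \<rho> (q e) i)"
      unfolding P distrib_left sum.distrib ..
    also have "\<dots> = to_fract (\<Sum>e\<in>I. [:w e:] * P e)"
      unfolding 0 to_fract_sum to_fract_mult by simp
    finally show ?thesis by blast
  qed
  have "\<forall>i. \<exists>P. i < N \<longrightarrow> (\<Sum>e\<in>I. ?c (w e) * (s_var ^ tt e * \<rho> (gc e) i)) = to_fract P"
    using poly by blast
  from choice[OF this] obtain P where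
    P: "\<And>i. i < N \<Longrightarrow> (\<Sum>e\<in>I. ?c (w e) * (s_var ^ tt e * \<rho> (gc e) i)) = to_fract (P i)"
    by blast
  \<comment> \<open>Multiplication by the constant matrix \<open>H\<close> keeps polynomials
    polynomial.\<close>
  have "(\<Sum>e\<in>I. ?c (w e) * s_var ^ tt e * Z $$ (x, yy e)) = to_fract (\<Sum>i<N. [:H $$ (x, i):] * P i)"
    if x: "x < dim_row Z" for x
  proof -
    have Zx: "Z $$ (x, yy e) = (\<Sum>i<N. ?c (H $$ (x, i)) * \<rho> (gc e) i)" if "e \<in> I" for e
    proof -
      have "Z = const_mat H * (R * const_mat G)"
        unfolding Z using H Rc G by (intro assoc_mult_mat[of _ "dim_row Z" N _ N _ "dim_col Z"]) auto
      moreover have "(R * const_mat G) $$ (i, yy e) = \<rho> (gc e) i" if "i < N" for i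
        using mult_mat_index_sum[OF Rc cG \<open>i < N\<close> yy[OF \<open>e \<in> I\<close>]] G yy[OF \<open>e \<in> I\<close>]
        by (simp add: const_mat_def \<rho>_def gc_def)
      moreover have "(const_mat H * (R * const_mat G)) $$ (x, yy e) =
          (\<Sum>i<N. ?c (H $$ (x, i)) * (R * const_mat G) $$ (i, yy e))"
        unfolding mult_mat_index_sum[OF cH mult_carrier_mat[OF Rc cG] x yy[OF that]]
        using H x by (intro sum.cong) (auto simp: const_mat_def)
      ultimately show ?thesis by simp
    qed
    have "(\<Sum>e\<in>I. ?c (w e) * s_var ^ tt e * Z $$ (x, yy e)) =
        (\<Sum>e\<in>I. \<Sum>i<N. ?c (H $$ (x, i)) * (?c (w e) * (s_var ^ tt e * \<rho> (gc e) i)))"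
      by (rule sum.cong) (simp_all only: Zx sum_distrib_left mult_ac)
    also have "\<dots> = (\<Sum>i<N. \<Sum>e\<in>I. ?c (H $$ (x, i)) * (?c (w e) * (s_var ^ tt e * \<rho> (gc e) i)))"
      by (rule sum.swap)
    also have "\<dots> = (\<Sum>i<N. ?c (H $$ (x, i)) * to_fract (P i))"
      by (rule sum.cong) (simp_all only: P lessThan_iff flip: sum_distrib_left)
    finally show ?thesis unfolding to_fract_sum to_fract_mult .
  qed
  with w(1) show ?thesis by blast
qed

text \<open>A polynomial has no negative powers of \<open>s_var\<close>, and the sum in the
  conclusion is the coefficient of the power -(s+1), with the natural number \<open>s\<close>: only
  \<open>i = s + tt e + 1\<close> contributes to it.\<close>

lemma polynomial_combination_coeffs:
  fixes \<phi> :: "nat \<Rightarrow> 'e \<Rightarrow> real"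
  assumes "finite I"
    and eq: "(\<Sum>e\<in>I. to_fract [:w e:] * s_var ^ tt e *
      (\<Sum>i=1..p. inverse s_var ^ i * to_fract [:\<phi> i e:])) = to_fract P"
    and zero: "\<And>i e. p < i \<Longrightarrow> e \<in> I \<Longrightarrow> \<phi> i e = 0"
  shows "(\<Sum>e\<in>I. w e * \<phi> (s + tt e + 1) e) = 0"
proof (cases "s < p")
  case True
  \<comment> \<open>The left side times \<open>s_var ^ p\<close>, which clears all
    denominators.\<close>
  define Q where "Q = (\<Sum>e\<in>I. \<Sum>i=1..p. monom (w e * \<phi> i e) (tt e + (p - i)))"
  have "to_fract (monom 1 p * P) = s_var ^ p * to_fract P"
    unfolding to_fract_mult s_var_pow ..
  also have "\<dots> = (\<Sum>e\<in>I. \<Sum>i=1..p. to_fract (monom (w e * \<phi> i e) (tt e + (p - i))))"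
    unfolding eq[symmetric] sum_distrib_left
  proof (intro sum.cong refl)
    fix e i assume "i \<in> {1..p}"
    then have "s_var ^ p = s_var ^ (p - i) * s_var ^ i" by (simp flip: power_add)
    then have p: "s_var ^ p * inverse s_var ^ i = s_var ^ (p - i)"
      using s_var_neq_0 by (simp add: mult.assoc flip: power_mult_distrib)
    have "s_var ^ p * (to_fract [:w e:] * s_var ^ tt e * (inverse s_var ^ i * to_fract [:\<phi> i e:])) =
        (to_fract [:w e:] * to_fract [:\<phi> i e:]) * (s_var ^ tt e * (s_var ^ p * inverse s_var ^ i))"
      by (simp only: mult_ac)
    also have "\<dots> = to_fract ([:w e * \<phi> i e:] * monom 1 (tt e + (p - i)))"
      unfolding p by (simp only: to_fract_mult const_mult s_var_pow[symmetric] power_add)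
    also have "[:w e * \<phi> i e:] * monom 1 (tt e + (p - i)) = monom (w e * \<phi> i e) (tt e + (p - i))"
      by (simp add: smult_monom)
    finally show "s_var ^ p * (to_fract [:w e:] * s_var ^ tt e * (inverse s_var ^ i * to_fract [:\<phi> i e:])) =
        to_fract (monom (w e * \<phi> i e) (tt e + (p - i)))" .
  qed
  also have "\<dots> = to_fract Q" unfolding Q_def to_fract_sum ..
  finally have "monom 1 p * P = Q" by (simp only: to_fract_eq_iff)
  \<comment> \<open>A multiple of the \<open>p\<close>-th power has no lower coefficients; index
    \<open>p - 1 - s\<close> stands for the original power -(s+1).\<close>
  then have "coeff Q (p - 1 - s) = 0" using True by (auto simp: coeff_monom_mult)
  moreover have "coeff Q (p - 1 - s) = (\<Sum>e\<in>I. w e * \<phi> (s + tt e + 1) e)"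
    unfolding Q_def coeff_sum
  proof (rule sum.cong[OF refl])
    fix e assume e: "e \<in> I"
    have "(\<Sum>i=1..p. coeff (monom (w e * \<phi> i e) (tt e + (p - i))) (p - 1 - s)) =
        (\<Sum>i=1..p. if i = s + tt e + 1 then w e * \<phi> i e else 0)"
      using True by (intro sum.cong) auto
    also have "\<dots> = w e * \<phi> (s + tt e + 1) e"
      using zero[of "s + tt e + 1" e] e by (auto simp: not_le)
    finally show "(\<Sum>i=1..p. coeff (monom (w e * \<phi> i e) (tt e + (p - i))) (p - 1 - s)) =
        w e * \<phi> (s + tt e + 1) e" .
  qed
  ultimately show ?thesis by simp
next
  case False
  then show ?thesis using zero by (intro sum.neutral) auto
qed

section \<open>The minimal Jordan realization\<close>

text \<open>The pivot decomposition of s^p Z(s), whose coefficient of index \<open>i\<close> is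
  \<open>\<Phi> (p - i)\<close>. A pivot of order \<open>e c < p\<close> gives a chain of length
  \<open>p - e c\<close>, so increasing orders become decreasing lengths.\<close>

lemma coefficient_decomposition:
  fixes \<Phi> :: "nat \<Rightarrow> real mat"
  shows "\<exists>(l::nat) n u v xs ys.
    (\<forall>c<l. n c \<in> {1..p} \<and> xs c < k \<and> ys c < m) \<and>
    (\<forall>c<l. fps_nth (u c (xs c)) 0 \<noteq> 0 \<and> fps_nth (v c (ys c)) 0 \<noteq> 0) \<and>
    (\<forall>c' c. c < c' \<longrightarrow> c' < l \<longrightarrow> u c' (xs c) = 0 \<and> v c' (ys c) = 0 \<and> n c' \<le> n c) \<and>
    (\<forall>i\<in>{1..p}. \<forall>x<k. \<forall>y<m. \<Phi> i $$ (x, y) =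
      (\<Sum>c<l. if i \<le> n c then fps_nth (u c x * v c y) (n c - i) else 0))"
proof -
  \<comment> \<open>Truncated subtraction puts \<open>\<Phi> 0\<close> at all indices from
    \<open>p\<close> on; the resulting identity is read only below \<open>p\<close>.\<close>
  define A where "A x y = (if x < k \<and> y < m then Abs_fps (\<lambda>i. \<Phi> (p - i) $$ (x, y)) else 0)" for x y
  have "\<forall>x y. x \<notin> {..<k} \<or> y \<notin> {..<m} \<longrightarrow> A x y = 0" by (auto simp: A_def)
  from fps_pivot_decomposition[OF finite_lessThan finite_lessThan this, of p]
  obtain l :: nat and e u v xs ys where
    "\<forall>c<l. xs c \<in> {..<k} \<and> ys c \<in> {..<m} \<and> e c < p"
    "\<forall>c<l. fps_nth (u c (xs c)) 0 \<noteq> 0 \<and> fps_nth (v c (ys c)) 0 \<noteq> 0"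
    "\<forall>c' c. c < c' \<longrightarrow> c' < l \<longrightarrow> u c' (xs c) = 0 \<and> v c' (ys c) = 0 \<and> e c \<le> e c'"
    "\<forall>x y. \<forall>i<p. fps_nth (A x y) i = fps_nth (\<Sum>c<l. fps_X ^ e c * u c x * v c y) i"
    by (elim exE conjE) (rule that; assumption)
  note dec = this
  have "\<Phi> i $$ (x, y) =
      (\<Sum>c<l. if i \<le> p - e c then fps_nth (u c x * v c y) (p - e c - i) else 0)"
    if "i \<in> {1..p}" "x < k" "y < m" for i x y
  proof -
    have "\<Phi> i $$ (x, y) = fps_nth (A x y) (p - i)" using that by (simp add: A_def)
    also have "\<dots> = (\<Sum>c<l. fps_nth (fps_X ^ e c * (u c x * v c y)) (p - i))"
      using dec(4) that by (simp add: fps_sum_nth mult.assoc)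
    also have "\<dots> = (\<Sum>c<l. if i \<le> p - e c then fps_nth (u c x * v c y) (p - e c - i) else 0)"
    proof (rule sum.cong[OF refl])
      fix c assume "c \<in> {..<l}"
      then have "e c < p" using dec(1) by simp
      then have "p - i < e c \<longleftrightarrow> \<not> i \<le> p - e c" "p - i - e c = p - e c - i" using that by auto
      then show "fps_nth (fps_X ^ e c * (u c x * v c y)) (p - i) =
          (if i \<le> p - e c then fps_nth (u c x * v c y) (p - e c - i) else 0)"
        unfolding fps_X_power_mult_nth by simp
    qed
    finally show ?thesis .
  qed
  then have "\<forall>i\<in>{1..p}. \<forall>x<k. \<forall>y<m. \<Phi> i $$ (x, y) =
      (\<Sum>c<l. if i \<le> p - e c then fps_nth (u c x * v c y) (p - e c - i) else 0)" by blast
  moreover have "\<forall>c<l. p - e c \<in> {1..p} \<and> xs c < k \<and> ys c < m"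
    using dec(1) by (auto simp: Suc_le_eq)
  moreover have "\<forall>c' c. c < c' \<longrightarrow> c' < l \<longrightarrow>
      u c' (xs c) = 0 \<and> v c' (ys c) = 0 \<and> p - e c' \<le> p - e c"
    using dec(3) by (auto intro: diff_le_mono2)
  moreover note dec(2)
  ultimately show ?thesis
    by - (rule exI[of _ l], rule exI[of _ "\<lambda>c. p - e c"], rule exI[of _ u], rule exI[of _ v],
        rule exI[of _ xs], rule exI[of _ ys], intro conjI)
qed

text \<open>Unknown \<open>(c,t)\<close> stands for column \<open>ys c\<close> of Z times s^t. With
  more unknowns than states, some nontrivial combination is polynomial; its vanishing negative
  coefficients at the pivot rows are the Hankel system, whose kernel is trivial.\<close>

lemma realization_dim_ge:
  fixes u v :: "nat \<Rightarrow> nat \<Rightarrow> real fps" and n xs ys :: "nat \<Rightarrow> nat" and l :: nat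
  assumes real: "realization H F G (transfer_matrix k m p \<Phi>)"
    and car: "\<forall>i\<in>{1..p}. \<Phi> i \<in> carrier_mat k m"
    and bnd: "\<And>c. c < l \<Longrightarrow> n c \<in> {1..p} \<and> xs c < k \<and> ys c < m"
    and piv: "\<And>c. c < l \<Longrightarrow> fps_nth (u c (xs c)) 0 \<noteq> 0 \<and> fps_nth (v c (ys c)) 0 \<noteq> 0"
    and tri: "\<And>c c'. c < c' \<Longrightarrow> c' < l \<Longrightarrow> u c' (xs c) = 0 \<and> v c' (ys c) = 0"
    and \<Phi>: "\<And>i x y. i \<in> {1..p} \<Longrightarrow> x < k \<Longrightarrow> y < m \<Longrightarrow> \<Phi> i $$ (x, y) =
      (\<Sum>c<l. if i \<le> n c then fps_nth (u c x * v c y) (n c - i) else 0)"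
  shows "(\<Sum>c<l. n c) \<le> dim_row F"
proof (rule ccontr)
  define I where "I = (SIGMA c:{..<l}. {..<n c})"
  define \<phi> where "\<phi> i x y = (\<Sum>c<l. if i \<le> n c then fps_nth (u c x * v c y) (n c - i) else 0)"
    for i x y
  have fin: "finite I" by (simp add: I_def)
  have "card I = (\<Sum>c<l. n c)" by (simp add: I_def)
  moreover assume "\<not> (\<Sum>c<l. n c) \<le> dim_row F"
  ultimately have card: "dim_row F < card I" by simp
  have dims: "dim_row (transfer_matrix k m p \<Phi>) = k" "dim_col (transfer_matrix k m p \<Phi>) = m"
    by (simp_all add: transfer_matrix_def sum_of_mats_def)
  have yI: "ys (fst e) < m" if "e \<in> I" for e using that bnd by (auto simp: I_def)
  from realization_polynomial_combination[OF real fin card, of "\<lambda>e. ys (fst e)" snd] yI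
  obtain w where w: "\<exists>e\<in>I. w e \<noteq> 0"
    and poly: "\<And>x. x < k \<Longrightarrow> \<exists>P. (\<Sum>e\<in>I. to_fract [:w e:] * s_var ^ snd e *
      transfer_matrix k m p \<Phi> $$ (x, ys (fst e))) = to_fract P"
    unfolding dims by blast
  have "(\<Sum>(c',t)\<in>I. w (c',t) * \<phi> (s + t + 1) (xs c) (ys c')) = 0" if c: "c < l" for c s
  proof -
    have x: "xs c < k" using bnd[OF c] by blast
    from poly[OF x] obtain P where P: "(\<Sum>e\<in>I. to_fract [:w e:] * s_var ^ snd e *
      transfer_matrix k m p \<Phi> $$ (xs c, ys (fst e))) = to_fract P" by blast
    have Z: "transfer_matrix k m p \<Phi> $$ (xs c, ys (fst e)) =
        (\<Sum>i=1..p. inverse s_var ^ i * to_fract [:\<phi> i (xs c) (ys (fst e)):])" if e: "e \<in> I" for e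
    proof -
      have "transfer_matrix k m p \<Phi> $$ (xs c, ys (fst e)) =
          (\<Sum>i=1..p. (inverse s_var ^ i \<cdot>\<^sub>m const_mat (\<Phi> i)) $$ (xs c, ys (fst e)))"
        using x yI[OF e] by (simp add: transfer_matrix_def sum_of_mats_def)
      also have "\<dots> = (\<Sum>i=1..p. inverse s_var ^ i * to_fract [:\<phi> i (xs c) (ys (fst e)):])"
      proof (rule sum.cong[OF refl])
        fix i assume i: "i \<in> {1..p}"
        then have "\<Phi> i \<in> carrier_mat k m" using car by blast
        then show "(inverse s_var ^ i \<cdot>\<^sub>m const_mat (\<Phi> i)) $$ (xs c, ys (fst e)) =
            inverse s_var ^ i * to_fract [:\<phi> i (xs c) (ys (fst e)):]"
          using x yI[OF e] \<Phi>[OF i x yI[OF e]] by (simp add: const_mat_def \<phi>_def)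
      qed
      finally show ?thesis .
    qed
    have "(\<Sum>e\<in>I. w e * \<phi> (s + snd e + 1) (xs c) (ys (fst e))) = 0"
    proof (rule polynomial_combination_coeffs[OF fin, of w snd "\<lambda>i e. \<phi> i (xs c) (ys (fst e))" p P])
      show "(\<Sum>e\<in>I. to_fract [:w e:] * s_var ^ snd e *
          (\<Sum>i=1..p. inverse s_var ^ i * to_fract [:\<phi> i (xs c) (ys (fst e)):])) = to_fract P"
        unfolding P[symmetric] by (intro sum.cong refl) (simp add: Z)
      show "\<phi> i (xs c) (ys (fst e)) = 0" if "p < i" for i e
        unfolding \<phi>_def
      proof (intro sum.neutral ballI)
        fix c' assume "c' \<in> {..<l}"
        then have "n c' < i" using bnd[of c'] that by auto
        then show "(if i \<le> n c' then fps_nth (u c' (xs c) * v c' (ys (fst e))) (n c' - i) else 0) = 0"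
          by simp
      qed
    qed
    then show ?thesis by (simp add: case_prod_unfold)
  qed
  note ker = this
  have "w e = 0" if "e \<in> I" for e
  proof (rule hankel_kernel_trivial[where \<phi> = \<phi> and u = u and v = v and xs = xs and ys = ys])
    show "e \<in> (SIGMA c:{..<l}. {..<n c})" using that by (simp add: I_def)
    show "(\<Sum>(c',t)\<in>(SIGMA c:{..<l}. {..<n c}). w (c',t) * \<phi> (s + t + 1) (xs c) (ys c')) = 0"
      if "c < l" for c s
      using ker[OF that] unfolding I_def .
  qed (fact piv tri \<phi>_def)+
  with w show False by blast
qed

theorem mainTheorem1:
  fixes k m p :: nat and \<Phi> :: "nat \<Rightarrow> real mat"
  assumes "k \<ge> 1" and "m \<ge> 1" and "p \<ge> 1"
    and "\<forall>i\<in>{1..p}. \<Phi> i \<in> carrier_mat k m"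
    and "\<Phi> p \<noteq> 0\<^sub>m k m"
  shows "\<exists>(d :: nat \<Rightarrow> nat) (G :: real mat) (H :: real mat).
    let l = (\<Sum>i\<in>{1..p}. d i);
        n = (\<Sum>i\<in>{1..p}. i * d i);
        F = nilpotent_jordan p d
    in d p > 0 \<and> l \<le> min k m \<and>
       G \<in> carrier_mat n m \<and> H \<in> carrier_mat k n \<and> F \<in> carrier_mat n n \<and>
       F ^\<^sub>m p = 0\<^sub>m n n \<and>
       minimal_realization H F G (transfer_matrix k m p \<Phi>) \<and>
       lag_representation H F G (lag_polynomial k m p \<Phi>) \<and>
       (\<forall>i\<in>{1..p}. \<Phi> i = H * F ^\<^sub>m (i - 1) * G) \<and>
       G_zero p d G \<in> carrier_mat l m \<and> vec_space.rank l (G_zero p d G) = l \<and>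
       H_zero p d H \<in> carrier_mat k l \<and> vec_space.rank k (H_zero p d H) = l \<and>
       (\<forall>x \<epsilon> y :: int \<Rightarrow> real vec.
          (\<forall>t. x t \<in> carrier_vec m \<and> \<epsilon> t \<in> carrier_vec k \<and> y t \<in> carrier_vec k) \<longrightarrow>
          (regression_model k p \<Phi> x \<epsilon> y \<longleftrightarrow>
           regression_model k p (\<lambda>i. H * F ^\<^sub>m (i - 1) * G) x \<epsilon> y))"
proof -
  note car = assms(4)
  obtain l :: nat and n u v xs ys where
    "\<forall>c<l. n c \<in> {1..p} \<and> xs c < k \<and> ys c < m"
    "\<forall>c<l. fps_nth (u c (xs c)) 0 \<noteq> 0 \<and> fps_nth (v c (ys c)) 0 \<noteq> 0"
    "\<forall>c' c. c < c' \<longrightarrow> c' < l \<longrightarrow> u c' (xs c) = 0 \<and> v c' (ys c) = 0 \<and> n c' \<le> n c"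
    "\<forall>i\<in>{1..p}. \<forall>x<k. \<forall>y<m. \<Phi> i $$ (x, y) =
      (\<Sum>c<l. if i \<le> n c then fps_nth (u c x * v c y) (n c - i) else 0)"
    using coefficient_decomposition[of p k m \<Phi>] by (elim exE conjE) (rule that; assumption)
  note dec = this
  have bnd: "\<And>c. c < l \<Longrightarrow> n c \<in> {1..p} \<and> xs c < k \<and> ys c < m" using dec(1) by blast
  have piv: "\<And>c. c < l \<Longrightarrow> fps_nth (u c (xs c)) 0 \<noteq> 0 \<and> fps_nth (v c (ys c)) 0 \<noteq> 0"
    using dec(2) by blast
  have tri: "\<And>c c'. c < c' \<Longrightarrow> c' < l \<Longrightarrow> u c' (xs c) = 0 \<and> v c' (ys c) = 0" using dec(3) by blast
  have anti: "\<And>c c'. c < c' \<Longrightarrow> c' < l \<Longrightarrow> n c' \<le> n c" using dec(3) by blast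
  have \<Phi>: "\<And>i x y. i \<in> {1..p} \<Longrightarrow> x < k \<Longrightarrow> y < m \<Longrightarrow> \<Phi> i $$ (x, y) =
      (\<Sum>c<l. if i \<le> n c then fps_nth (u c x * v c y) (n c - i) else 0)" using dec(4) by blast

  \<comment> \<open>The structure is read off the decomposition: \<open>d r\<close> counts the
    chains of length \<open>r\<close>.\<close>
  define d where "d = (\<lambda>r. card {c. c < l \<and> n c = r})"
  have bnd': "\<And>c. c < l \<Longrightarrow> n c \<in> {1..p}" using bnd by blast
  have sum_d: "(\<Sum>r=1..p. d r) = l"
    unfolding d_def by (rule offset_multiplicities(1)) (fact anti, fact bnd')
  have n_off: "n (offset p d r + b) = r" if "r \<in> {1..p}" "b < d r" for r b
    unfolding d_def
    by (rule offset_multiplicities(2)) (fact anti, fact bnd', use that in \<open>simp_all add: d_def\<close>)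
  define N where "N = (\<Sum>r=1..p. r * d r)"
  define F where "F = nilpotent_jordan p d"
  \<comment> \<open>The total chain length is the size of F, so the lower bound on state dimensions
    is attained.\<close>
  have N: "(\<Sum>c<l. n c) = N"
    unfolding sum_d[symmetric] sum_offset N_def using n_off by (intro sum.cong) auto
  have F: "F \<in> carrier_mat N N" unfolding F_def N_def by (rule nilpotent_jordan_carrier)
  have nil: "F ^\<^sub>m p = 0\<^sub>m N N" unfolding F_def N_def by (rule nilpotent_jordan_pow_eq_0)
  let ?off = "offset p (\<lambda>r. r * d r)"
  have off: "?off r + q < N" if "r \<in> {1..p}" "q < r * d r" for r q
    unfolding N_def by (rule offset_less[where w = "\<lambda>r. r * d r", OF that])

  \<comment> \<open>A nonzero entry of \<open>\<Phi> p\<close> requires a chain of length at least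
    \<open>p\<close>, and no chain is longer.\<close>
  have "d p > 0"
  proof -
    have "p \<in> {1..p}" using \<open>p \<ge> 1\<close> by simp
    then have "\<Phi> p \<in> carrier_mat k m" using car by blast
    with assms(5) obtain x y where xy: "x < k" "y < m" "\<Phi> p $$ (x, y) \<noteq> 0"
      by (metis carrier_matD eq_matI index_zero_mat)
    then have "(\<Sum>c<l. if p \<le> n c then fps_nth (u c x * v c y) (n c - p) else 0) \<noteq> 0"
      using \<Phi>[OF \<open>p \<in> {1..p}\<close> xy(1,2)] by simp
    then have "\<exists>c\<in>{..<l}. (if p \<le> n c then fps_nth (u c x * v c y) (n c - p) else 0) \<noteq> 0"
      using sum.neutral[of "{..<l}" "\<lambda>c. if p \<le> n c then fps_nth (u c x * v c y) (n c - p) else 0"] by blast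
    then obtain c where "c < l" "p \<le> n c" by (auto split: if_splits)
    then have "c \<in> {c. c < l \<and> n c = p}" using bnd[of c] by auto
    then show ?thesis unfolding d_def by (auto simp: card_gt_0_iff)
  qed
  \<comment> \<open>A later chain vanishes at earlier pivots but not at its own, so pivot rows are
    distinct, and so are pivot columns; hence the bounds by \<open>k\<close> and
    \<open>m\<close>.\<close>
  have "xs c \<noteq> xs c'" "ys c \<noteq> ys c'" if "c < c'" "c' < l" for c c'
    using piv[OF that(2)] tri[OF that] by auto
  then have "inj_on xs {..<l}" "inj_on ys {..<l}"
    by (auto intro!: linorder_inj_onI')
  then have "l \<le> min k m"
    using card_inj_on_le[of xs "{..<l}" "{..<k}"] card_inj_on_le[of ys "{..<l}" "{..<m}"] bnd by auto

  \<comment> \<open>Position \<open>q\<close> belongs to chain \<open>q mod d r\<close> at place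
    \<open>q div d r\<close>. The coefficients of u ascend along the columns of \<open>H\<close>,
    those of v descend along the rows of \<open>G\<close>.\<close>
  obtain h where h: "\<forall>r\<in>{1..p}. \<forall>q<r * d r.
      h (?off r + q) = (\<lambda>x. fps_nth (u (offset p d r + q mod d r) x) (q div d r))"
    using offset_choice[where w = "\<lambda>r. r * d r"
        and g = "\<lambda>r q x. fps_nth (u (offset p d r + q mod d r) x) (q div d r)"] by blast
  obtain g where g: "\<forall>r\<in>{1..p}. \<forall>q<r * d r.
      g (?off r + q) = (\<lambda>y. fps_nth (v (offset p d r + q mod d r) y) (r - 1 - q div d r))"
    using offset_choice[where w = "\<lambda>r. r * d r"
        and g = "\<lambda>r q y. fps_nth (v (offset p d r + q mod d r) y) (r - 1 - q div d r)"] by blast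
  define H where "H = mat k N (\<lambda>(x, s). h s x)"
  define G where "G = mat N m (\<lambda>(s, y). g s y)"
  have H: "H \<in> carrier_mat k N" and G: "G \<in> carrier_mat N m" by (simp_all add: H_def G_def)
  have Hu: "H $$ (x, ?off r + q) = fps_nth (u (offset p d r + q mod d r) x) (q div d r)"
    if "r \<in> {1..p}" "q < r * d r" "x < k" for r q x
    using h off that by (simp add: H_def)
  have Gv: "G $$ (?off r + q, y) = fps_nth (v (offset p d r + q mod d r) y) (r - 1 - q div d r)"
    if "r \<in> {1..p}" "q < r * d r" "y < m" for r q y
    using g off that by (simp add: G_def)

  have markov: "\<Phi> i = H * F ^\<^sub>m (i - 1) * G" if i: "i \<in> {1..p}" for i
  proof (rule eq_matI)
    have HFG: "H * F ^\<^sub>m (i - 1) * G \<in> carrier_mat k m" using H F G by auto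
    have \<Phi>i: "\<Phi> i \<in> carrier_mat k m" using car i by blast
    show "dim_row (\<Phi> i) = dim_row (H * F ^\<^sub>m (i - 1) * G)"
      "dim_col (\<Phi> i) = dim_col (H * F ^\<^sub>m (i - 1) * G)" using HFG \<Phi>i by auto
    fix x y assume "x < dim_row (H * F ^\<^sub>m (i - 1) * G)" "y < dim_col (H * F ^\<^sub>m (i - 1) * G)"
    then have xy: "x < k" "y < m" using HFG by auto
    have "(H * F ^\<^sub>m (i - 1) * G) $$ (x, y) = (\<Sum>r=1..p. \<Sum>b<d r. if i \<le> r
        then fps_nth (u (offset p d r + b) x * v (offset p d r + b) y) (r - i) else 0)"
    proof -
      have "(H * F ^\<^sub>m (i - 1) * G) $$ (x, y) = (\<Sum>r=1..p. \<Sum>b<d r. if i - 1 + 1 \<le> r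
          then fps_nth (u (offset p d r + b) x * v (offset p d r + b) y) (r - (i - 1 + 1)) else 0)"
        unfolding F_def
        by (rule jordan_chain_markov[OF H[unfolded N_def] G[unfolded N_def] _ _ xy]) (fact Hu, fact Gv)
      moreover have "i - 1 + 1 = i" using i by simp
      ultimately show ?thesis by (simp only:)
    qed
    also have "\<dots> = (\<Sum>c<l. if i \<le> n c then fps_nth (u c x * v c y) (n c - i) else 0)"
      unfolding sum_d[symmetric] sum_offset using n_off by (intro sum.cong) auto
    finally show "\<Phi> i $$ (x, y) = (H * F ^\<^sub>m (i - 1) * G) $$ (x, y)"
      using \<Phi>[OF i xy] by simp
  qed
  have real: "realization H F G (transfer_matrix k m p \<Phi>)"
    and lag: "lag_representation H F G (lag_polynomial k m p \<Phi>)"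
    by (rule nilpotent_realization[OF H F G nil], erule markov)+
  have minimal: "minimal_realization H F G (transfer_matrix k m p \<Phi>)"
    unfolding minimal_realization_def
  proof (intro conjI allI impI)
    fix H' F' G' assume "realization H' F' G' (transfer_matrix k m p \<Phi>)"
    then have "(\<Sum>c<l. n c) \<le> dim_row F'"
      by (rule realization_dim_ge[where u = u and v = v and xs = xs and ys = ys])
        (fact car bnd piv tri \<Phi>)+
    then show "dim_row F \<le> dim_row F'" using F by (simp add: N)
  qed (rule real)

  have chain: "\<exists>r\<in>{1..p}. \<exists>b<d r. c = offset p d r + b" if "c < l" for c
    using offset_surj[of c d p] that sum_d by simp
  have G0: "G_zero p d G \<in> carrier_mat l m" using G_zero_carrier[of p d G] G sum_d by simp
  have G0_index: "G_zero p d G $$ (c, y) = fps_nth (v c y) 0" if c: "c < l" and y: "y < m" for c y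
  proof -
    from chain[OF c] obtain r b where rb: "r \<in> {1..p}" "b < d r" "c = offset p d r + b" by blast
    \<comment> \<open>The block with \<open>j = 0\<close> is at the last place \<open>r - 1\<close>,
      where \<open>G\<close> holds the constant term of v.\<close>
    have "Suc (r - 1) * d r = r * d r" using rb(1) by simp
    then have "(r - 1) * d r + b < r * d r" using rb(2) by simp
    then show ?thesis
      using G_zero_index[of r p b d y G] Gv[OF rb(1), of "(r - 1) * d r + b" y] rb y G by simp
  qed
  have H0: "H_zero p d H \<in> carrier_mat k l" using H_zero_carrier[of p d H] H sum_d by simp
  have H0_index: "H_zero p d H $$ (x, c) = fps_nth (u c x) 0" if c: "c < l" and x: "x < k" for c x
  proof -
    from chain[OF c] obtain r b where rb: "r \<in> {1..p}" "b < d r" "c = offset p d r + b" by blast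
    have "1 * d r \<le> r * d r" using rb(1) by (intro mult_le_mono1) simp
    then have "b < r * d r" using rb(2) by linarith
    then show ?thesis
      using H_zero_index[of r p b d x H] Hu[OF rb(1), of b x] rb x H by simp
  qed
  have rank_G: "vec_space.rank l (G_zero p d G) = l"
    by (rule rank_echelon_rows[OF G0, of ys]) (use bnd piv tri G0_index in auto)
  have rank_H: "vec_space.rank k (H_zero p d H) = l"
    by (rule rank_echelon_cols[OF H0, of xs]) (use bnd piv tri H0_index in auto)

  have regression: "regression_model k p \<Phi> x \<epsilon> y \<longleftrightarrow>
      regression_model k p (\<lambda>i. H * F ^\<^sub>m (i - 1) * G) x \<epsilon> y"
    if x: "\<forall>t. x t \<in> carrier_vec m \<and> \<epsilon> t \<in> carrier_vec k \<and> y t \<in> carrier_vec k"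
    for x \<epsilon> y :: "int \<Rightarrow> real vec"
  proof -
    have "finsum_vec TYPE(real) k (\<lambda>i. \<Phi> i *\<^sub>v x (t - int i)) {1..p} =
        finsum_vec TYPE(real) k (\<lambda>i. H * F ^\<^sub>m (i - 1) * G *\<^sub>v x (t - int i)) {1..p}" for t
      unfolding finsum_vec_def
    \<comment> \<open>Congruence for sums of vectors needs the summands in the carrier, which is
      where the dimensions of \<open>x\<close> enter.\<close>
    proof (rule comm_monoid.finprod_cong'[OF comm_monoid_vec refl])
      show "(\<lambda>i. H * F ^\<^sub>m (i - 1) * G *\<^sub>v x (t - int i)) \<in> {1..p} \<rightarrow> carrier (monoid_vec TYPE(real) k)"
        unfolding monoid_vec_simps using H F G x by (intro funcsetI mult_mat_vec_carrier[of _ k m]) auto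
    qed (simp only: markov)
    then show ?thesis unfolding regression_model_def by simp
  qed

  show ?thesis
  proof (rule exI[of _ d], rule exI[of _ G], rule exI[of _ H], unfold Let_def sum_d,
      fold N_def F_def, intro conjI)
    show "\<forall>i\<in>{1..p}. \<Phi> i = H * F ^\<^sub>m (i - 1) * G" using markov by blast
    show "\<forall>x \<epsilon> y :: int \<Rightarrow> real vec.
        (\<forall>t. x t \<in> carrier_vec m \<and> \<epsilon> t \<in> carrier_vec k \<and> y t \<in> carrier_vec k) \<longrightarrow>
        (regression_model k p \<Phi> x \<epsilon> y \<longleftrightarrow>
         regression_model k p (\<lambda>i. H * F ^\<^sub>m (i - 1) * G) x \<epsilon> y)" using regression by blast
  qed fact+
qed

end
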